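(* Let $R$ be a commutative Noetherian ring, let $N \subseteq M$ be finitely generated $R$-modules, let $\mathscr{E}$ be an $R$-submodule of $\mathrm{Hom}_R(M,R)$, and let $X = j\text{-}\mathrm{Spec}(R)$. Assume that for each $\mathfrak{p} \in X$ the module $M_\mathfrak{p}$ contains a free $\mathscr{E}_\mathfrak{p}$-summand $F(\mathfrak{p})$ of rank at least $i + \dim_X(\mathfrak{p})$, for some fixed positive integer $i$. Then $M$ contains a free $\mathscr{E}$-summand $F$ of rank at least $i$. Furthermore, if $F(\mathfrak{p}) \subseteq N_\mathfrak{p}$ for all $\mathfrak{p} \in X$, then $F$ can be chosen with $F \subseteq N$.
   Context: $j\text{-}\mathrm{Spec}(R)$ denotes the set of prime ideals of $R$ that are intersections of maximal ideals. For $X \subseteq \mathrm{Spec}(R)$ and $\mathfrak{p} \in X$, $\dim_X(\mathfrak{p})$ is the supremum of the lengths $n$ of chains $\mathfrak{p} = \mathfrak{p}_0 \subsetneq \cdots \subsetneq \mathfrak{p}_n$ with all $\mathfrak{p}_k \in X$. For a finitely generated $R$-module $M$ and an $R$-submodule $\mathscr{E} \subseteq \mathrm{Hom}_R(M,R)$, a free $\mathscr{E}$-summand of $M$ is a direct summand $F$ of $M$ (say $M = F \oplus G$) with $F \cong R^n$ such that the projection $M \to F \cong R^n$ along $G$ has each of its $n$ coordinate functions in $\mathscr{E}$ (this does not depend on the choice of isomorphism $F \cong R^n$). For a prime $\mathfrak{p}$, $\mathscr{E}_\mathfrak{p}$ is viewed as an $R_\mathfrak{p}$-submodule of $\mathrm{Hom}_{R_\mathfrak{p}}(M_\mathfrak{p},R_\mathfrak{p})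 = \mathrm{Hom}_R(M,R)_\mathfrak{p}$, and free $\mathscr{E}_\mathfrak{p}$-summands of $M_\mathfrak{p}$ are defined analogously over $R_\mathfrak{p}$. *)

theory Defs
  imports "HOL-Algebra.Algebra" "HOL-Library.Extended_Nat"
begin

definition fin_gen :: "('a,'r) ring_scheme \<Rightarrow> ('a,'m) module \<Rightarrow> bool" where
  "fin_gen R M \<longleftrightarrow> (\<exists>A. finite A \<and> A \<subseteq> carrier M \<and>
     (\<forall>x\<in>carrier M. \<exists>c \<in> A \<rightarrow> carrier R. x = finsum M (\<lambda>a. c a \<odot>\<^bsub>M\<^esub> a) A))"

definition lin_forms :: "('a,'r) ring_scheme \<Rightarrow> ('a,'m) module \<Rightarrow> ('m \<Rightarrow> 'a) set" where
  "lin_forms R M = {f \<in> carrier M \<rightarrow>\<^sub>E carrier R.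
     (\<forall>x\<in>carrier M. \<forall>y\<in>carrier M. f (x \<oplus>\<^bsub>M\<^esub> y) = f x \<oplus>\<^bsub>R\<^esub> f y) \<and>
     (\<forall>a\<in>carrier R. \<forall>x\<in>carrier M. f (a \<odot>\<^bsub>M\<^esub> x) = a \<otimes>\<^bsub>R\<^esub> f x)}"

definition hom_submodule :: "('a,'r) ring_scheme \<Rightarrow> ('a,'m) module \<Rightarrow> ('m \<Rightarrow> 'a) set \<Rightarrow> bool" where
  "hom_submodule R M E \<longleftrightarrow> E \<subseteq> lin_forms R M \<and>
     (\<lambda>x\<in>carrier M. \<zero>\<^bsub>R\<^esub>) \<in> E \<and>
     (\<forall>e1\<in>E. \<forall>e2\<in>E. (\<lambda>x\<in>carrier M. e1 x \<oplus>\<^bsub>R\<^esub> e2 x) \<in> E) \<and>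
     (\<forall>a\<in>carrier R. \<forall>e\<in>E. (\<lambda>x\<in>carrier M. a \<otimes>\<^bsub>R\<^esub> e x) \<in> E)"

text \<open>F is a free E-summand of M of rank n: M = F \<oplus> G, b_0..b_{n-1} is a basis of F
  (giving F \<cong> R^n), and the coordinate functions phi_k of the projection M \<rightarrow> F along G
  (with respect to this basis) lie in E.\<close>
definition free_E_summand ::
  "('a,'r) ring_scheme \<Rightarrow> ('a,'m) module \<Rightarrow> ('m \<Rightarrow> 'a) set \<Rightarrow> 'm set \<Rightarrow> nat \<Rightarrow> bool" where
  "free_E_summand R M E F n \<longleftrightarrow> submodule F R M \<and>
     (\<exists>G. submodule G R M \<and> F \<inter> G = {\<zero>\<^bsub>M\<^esub>} \<and> F <+>\<^bsub>M\<^esub> G = carrier M \<and>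
       (\<exists>b \<phi>. b \<in> {..<n} \<rightarrow> F \<and>
          (\<forall>x\<in>F. \<exists>!c. c \<in> {..<n} \<rightarrow>\<^sub>E carrier R \<and>
                 x = finsum M (\<lambda>k. c k \<odot>\<^bsub>M\<^esub> b k) {..<n}) \<and>
          (\<forall>k<n. \<phi> k \<in> E \<and> \<phi> k \<in> carrier M \<rightarrow> carrier R) \<and>
          (\<forall>x\<in>carrier M. x \<ominus>\<^bsub>M\<^esub> finsum M (\<lambda>k. \<phi> k x \<odot>\<^bsub>M\<^esub> b k) {..<n} \<in> G)))"

definition loc_rel_ring :: "('a,'r) ring_scheme \<Rightarrow> 'a set \<Rightarrow> (('a \<times> 'a) \<times> ('a \<times> 'a)) set" where
  "loc_rel_ring R p = {((r,s),(r',s')). r \<in> carrier R \<and> r' \<in> carrier R \<and>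
      s \<in> carrier R - p \<and> s' \<in> carrier R - p \<and>
      (\<exists>t \<in> carrier R - p. t \<otimes>\<^bsub>R\<^esub> (s' \<otimes>\<^bsub>R\<^esub> r \<ominus>\<^bsub>R\<^esub> s \<otimes>\<^bsub>R\<^esub> r') = \<zero>\<^bsub>R\<^esub>)}"

definition loc_rel_mod :: "('a,'r) ring_scheme \<Rightarrow> ('a,'m) module \<Rightarrow> 'a set \<Rightarrow> (('m \<times> 'a) \<times> ('m \<times> 'a)) set" where
  "loc_rel_mod R M p = {((m,s),(m',s')). m \<in> carrier M \<and> m' \<in> carrier M \<and>
      s \<in> carrier R - p \<and> s' \<in> carrier R - p \<and>
      (\<exists>t \<in> carrier R - p. t \<odot>\<^bsub>M\<^esub> (s' \<odot>\<^bsub>M\<^esub> m \<ominus>\<^bsub>M\<^esub> s \<odot>\<^bsub>M\<^esub> m') = \<zero>\<^bsub>M\<^esub>)}"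

definition loc_ring :: "('a,'r) ring_scheme \<Rightarrow> 'a set \<Rightarrow> ('a \<times> 'a) set ring" where
  "loc_ring R p = (let Q = loc_rel_ring R p in
     \<lparr> carrier = (carrier R \<times> (carrier R - p)) // Q,
       monoid.mult = (\<lambda>U V. \<Union>{Q `` {(r \<otimes>\<^bsub>R\<^esub> r', s \<otimes>\<^bsub>R\<^esub> s')} | r s r' s'. (r,s) \<in> U \<and> (r',s') \<in> V}),
       monoid.one = Q `` {(\<one>\<^bsub>R\<^esub>, \<one>\<^bsub>R\<^esub>)},
       ring.zero = Q `` {(\<zero>\<^bsub>R\<^esub>, \<one>\<^bsub>R\<^esub>)},
       ring.add = (\<lambda>U V. \<Union>{Q `` {(s' \<otimes>\<^bsub>R\<^esub> r \<oplus>\<^bsub>R\<^esub> s \<otimes>\<^bsub>R\<^esub> r', s \<otimes>\<^bsub>R\<^esub> s')} | r s r' s'. (r,s) \<in> U \<and> (r',s') \<in> V}) \<rparr>)"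

definition loc_module :: "('a,'r) ring_scheme \<Rightarrow> ('a,'m) module \<Rightarrow> 'a set \<Rightarrow> (('a \<times> 'a) set, ('m \<times> 'a) set) module" where
  "loc_module R M p = (let Q = loc_rel_mod R M p; QR = loc_rel_ring R p in
     \<lparr> carrier = (carrier M \<times> (carrier R - p)) // Q,
       monoid.mult = (\<lambda>U V. undefined),
       monoid.one = undefined,
       ring.zero = Q `` {(\<zero>\<^bsub>M\<^esub>, \<one>\<^bsub>R\<^esub>)},
       ring.add = (\<lambda>U V. \<Union>{Q `` {(s' \<odot>\<^bsub>M\<^esub> m \<oplus>\<^bsub>M\<^esub> s \<odot>\<^bsub>M\<^esub> m', s \<otimes>\<^bsub>R\<^esub> s')} | m s m' s'. (m,s) \<in> U \<and> (m',s') \<in> V}),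
       module.smult = (\<lambda>A U. \<Union>{Q `` {(r \<odot>\<^bsub>M\<^esub> m, s \<otimes>\<^bsub>R\<^esub> t)} | r s m t. (r,s) \<in> A \<and> (m,t) \<in> U}) \<rparr>)"

text \<open>E_p viewed inside Hom_{R_p}(M_p,R_p): e/s acts by m/t \<mapsto> e(m)/(st).\<close>
definition loc_forms :: "('a,'r) ring_scheme \<Rightarrow> ('a,'m) module \<Rightarrow> ('m \<Rightarrow> 'a) set \<Rightarrow> 'a set \<Rightarrow> (('m \<times> 'a) set \<Rightarrow> ('a \<times> 'a) set) set" where
  "loc_forms R M E p = (\<lambda>(e,s). (\<lambda>U\<in>carrier (loc_module R M p).
       \<Union>{loc_rel_ring R p `` {(e m, s \<otimes>\<^bsub>R\<^esub> t)} | m t. (m,t) \<in> U})) ` (E \<times> (carrier R - p))"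

definition loc_sub :: "('a,'r) ring_scheme \<Rightarrow> ('a,'m) module \<Rightarrow> 'm set \<Rightarrow> 'a set \<Rightarrow> ('m \<times> 'a) set set" where
  "loc_sub R M N p = {loc_rel_mod R M p `` {(x,s)} | x s. x \<in> N \<and> s \<in> carrier R - p}"

definition j_spec :: "('a,'r) ring_scheme \<Rightarrow> 'a set set" where
  "j_spec R = {p. primeideal p R \<and> (\<exists>S. S \<noteq> {} \<and> (\<forall>m\<in>S. maximalideal m R) \<and> p = \<Inter>S)}"

definition dim_in :: "'a set set \<Rightarrow> 'a set \<Rightarrow> enat" where
  "dim_in XX p = (SUP n \<in> {n. \<exists>c. c 0 = p \<and> (\<forall>k\<le>n. c k \<in> XX) \<and> (\<forall>k<n. c k \<subset> c (Suc k))}. enat n)"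

end

theory Submission
  imports Defs
begin

text \<open>Everything is read off from the pairing of \<open>E\<close> with \<open>N\<close>. A free \<open>E\<close>-summand of rank
  \<open>n\<close> inside \<open>N\<close> is the same as forms \<open>e\<^sub>k \<in> E\<close> and vectors \<open>x\<^sub>j \<in> N\<close> with
  \<open>e\<^sub>k x\<^sub>j = \<delta>\<^sub>k\<^sub>j\<close>, \<open>k, j < n\<close>; the local hypothesis says that over the residue field at
  \<open>p\<close> the pairing has rank at least \<open>i + dim p\<close>. Starting from \<open>s\<close> generators of \<open>N\<close>, the last
  vector is added with suitable coefficients to the others, so that at every \<open>p\<close> in the
  j-spectrum the rank stays at least \<open>min (s - 1) (i + dim p)\<close> (Eisenbud and Evans). This needs care
  only at primes where the rank is exactly \<open>i + dim p < s\<close>. Since rank is lower semicontinuous and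
  dimension drops under specialisation, Noetherian induction shows that there are finitely
  many of them, and they can be treated one after another. With \<open>i\<close> vectors left, the rank is \<open>i\<close>
  at every maximal ideal, so dual forms exist locally, hence globally.\<close>

section \<open>Rank over residue fields\<close>

text \<open>The obstacle is that a change made for one prime may spoil another. Adding a multiple of
  one vector to another is invertible, so it keeps the rank of the whole family at every prime; what
  it can spoil is the rank of the family without its last vector. Removing a vector costs at most
  one, so a prime whose rank has one to spare needs no repair. A correction at p is multiplied by a
  scalar that lies in all critical primes treated before but not in p, and so does not disturb them.
  The j-spectrum enters twice: a prime in it that contains an ideal also contains the intersection
  of the maximal ideals above that ideal, so the Noetherian induction can pass to primes of the
  j-spectrum or to larger ideals; and all maximal ideals belong to it, which is where the final rank
  is read off. Fractions are avoided up to the last section: independence over the residue field is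
  expressed by forms and vectors over R itself whose pairing matrix is diagonal modulo p, with
  diagonal entries outside p.\<close>

lemma (in primeideal) minus_notin:
  assumes "x \<in> carrier R" "x \<notin> I" "y \<in> I"
  shows "x \<ominus> y \<notin> I"
proof
  assume "x \<ominus> y \<in> I"
  then have "(x \<ominus> y) \<oplus> y \<in> I"
    using assms by simp
  moreover have "(x \<ominus> y) \<oplus> y = x"
    using assms Icarr by (simp add: a_minus_def a_assoc l_neg)
  ultimately show False
    using assms by simp
qed

lemma (in ideal) minus_in: "x \<in> I \<Longrightarrow> y \<in> I \<Longrightarrow> x \<ominus> y \<in> I"
  by (simp add: a_minus_def)

lemma (in primeideal) mult_notin:
  "x \<in> carrier R \<Longrightarrow> y \<in> carrier R \<Longrightarrow> x \<notin> I \<Longrightarrow> y \<notin> I \<Longrightarrow> x \<otimes> y \<notin> I"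
  using I_prime by blast

lemma (in primeideal) one_notin: "\<one> \<notin> I"
  using one_imp_carrier I_notcarr by auto

section \<open>Forms in \<open>E\<close> and independence modulo a prime\<close>

locale form_space = module R M
  for R :: "('a,'r) ring_scheme" (structure) and M :: "('a,'m) module" (structure) +
  fixes E :: "('m \<Rightarrow> 'a) set"
  assumes E: "hom_submodule R M E"
begin

lemma form_closed [simp, intro]: "f \<in> E \<Longrightarrow> y \<in> carrier M \<Longrightarrow> f y \<in> carrier R"
  using E unfolding hom_submodule_def lin_forms_def by blast

lemma form_add:
  "f \<in> E \<Longrightarrow> x \<in> carrier M \<Longrightarrow> y \<in> carrier M \<Longrightarrow> f (x \<oplus>\<^bsub>M\<^esub> y) = f x \<oplus> f y"
  using E unfolding hom_submodule_def lin_forms_def by blast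

lemma form_smult:
  "f \<in> E \<Longrightarrow> a \<in> carrier R \<Longrightarrow> x \<in> carrier M \<Longrightarrow> f (a \<odot>\<^bsub>M\<^esub> x) = a \<otimes> f x"
  using E unfolding hom_submodule_def lin_forms_def by blast

lemma form_zero: "f \<in> E \<Longrightarrow> f \<zero>\<^bsub>M\<^esub> = \<zero>"
  using form_smult[of f \<zero> "\<zero>\<^bsub>M\<^esub>"] by simp

text \<open>A 2 by 2 determinant: for \<open>a = g z\<close> and \<open>b = f z\<close> it vanishes
  at \<open>z\<close>, which replaces division by the pivot \<open>g z\<close>. It is restricted
  because members of \<open>E\<close> are extensional.\<close>

definition comb :: "'a \<Rightarrow> ('m \<Rightarrow> 'a) \<Rightarrow> 'a \<Rightarrow> ('m \<Rightarrow> 'a) \<Rightarrow> 'm \<Rightarrow> 'a" where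
  "comb a f b g = (\<lambda>y\<in>carrier M. a \<otimes> f y \<ominus> b \<otimes> g y)"

lemma comb_in:
  assumes "a \<in> carrier R" "b \<in> carrier R" "f \<in> E" "g \<in> E"
  shows "comb a f b g \<in> E"
proof -
  have smul: "\<And>c e. c \<in> carrier R \<Longrightarrow> e \<in> E \<Longrightarrow> (\<lambda>x\<in>carrier M. c \<otimes> e x) \<in> E"
    and add: "\<And>e1 e2. e1 \<in> E \<Longrightarrow> e2 \<in> E \<Longrightarrow> (\<lambda>x\<in>carrier M. e1 x \<oplus> e2 x) \<in> E"
    using E unfolding hom_submodule_def by blast+
  have "(\<lambda>x\<in>carrier M. (\<lambda>x\<in>carrier M. a \<otimes> f x) x \<oplus> (\<lambda>x\<in>carrier M. (\<ominus> b) \<otimes> g x) x) \<in> E"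
    using assms by (intro add smul) auto
  also have "(\<lambda>x\<in>carrier M. (\<lambda>x\<in>carrier M. a \<otimes> f x) x \<oplus> (\<lambda>x\<in>carrier M. (\<ominus> b) \<otimes> g x) x)
      = comb a f b g"
    unfolding comb_def using assms by (intro restrict_ext) (simp add: a_minus_def l_minus)
  finally show ?thesis .
qed

lemma comb_apply [simp]: "y \<in> carrier M \<Longrightarrow> comb a f b g y = a \<otimes> f y \<ominus> b \<otimes> g y"
  by (simp add: comb_def)

text \<open>Over the residue field at \<open>p\<close>, the forms \<open>u k\<close> are up to nonzero scalars a dual
  family to the vectors \<open>x k\<close>, \<open>k \<in> J\<close>.\<close>
definition dual_at :: "'a set \<Rightarrow> 'i set \<Rightarrow> ('i \<Rightarrow> 'm) \<Rightarrow> ('i \<Rightarrow> 'm \<Rightarrow> 'a) \<Rightarrow> bool" where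
  "dual_at p J x u \<longleftrightarrow> (\<forall>k\<in>J. u k \<in> E \<and> x k \<in> carrier M \<and> u k (x k) \<notin> p \<and>
     (\<forall>j\<in>J - {k}. u k (x j) \<in> p))"

text \<open>For finite \<open>J\<close> and prime \<open>p\<close> this is linear independence, over
  the residue field, of the evaluations of forms in \<open>E\<close> at the \<open>x k\<close>. A
  family is meant: a vector that occurs twice makes it dependent.\<close>

definition indep_at :: "'a set \<Rightarrow> 'i set \<Rightarrow> ('i \<Rightarrow> 'm) \<Rightarrow> bool" where
  "indep_at p J x \<longleftrightarrow> (\<exists>u. dual_at p J x u)"

lemma dual_atD:
  assumes "dual_at p J x u" "k \<in> J"
  shows "u k \<in> E" "x k \<in> carrier M" "u k (x k) \<notin> p" "\<And>j. j \<in> J \<Longrightarrow> j \<noteq> k \<Longrightarrow> u k (x j) \<in> p"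
  using assms unfolding dual_at_def by auto

lemma dual_at_mono: "dual_at p J x u \<Longrightarrow> K \<subseteq> J \<Longrightarrow> dual_at p K x u"
  unfolding dual_at_def by blast

lemma indep_at_mono: "indep_at p J x \<Longrightarrow> K \<subseteq> J \<Longrightarrow> indep_at p K x"
  unfolding indep_at_def using dual_at_mono by blast

lemma indep_at_cong:
  assumes "indep_at p J x" "\<And>k. k \<in> J \<Longrightarrow> x k = y k"
  shows "indep_at p J y"
  using assms unfolding indep_at_def dual_at_def by (metis DiffD1)

text \<open>Steinitz exchange. \<open>u l\<close> becomes the dual form of \<open>z\<close>, and a
  multiple of it is subtracted from every other form to make that form vanish at \<open>z\<close>.
  This is harmless elsewhere, since \<open>u l\<close> is zero modulo \<open>p\<close> at the
  remaining vectors and the pivot \<open>u l z\<close> is outside \<open>p\<close>. The index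
  \<open>k\<close> may be \<open>l\<close> or a new one, so vectors can be replaced in place or
  moved.\<close>

lemma indep_at_exchange:
  assumes p: "primeideal p R" and d: "dual_at p J x u" and l: "l \<in> J" and k: "k \<notin> J - {l}"
    and z: "z \<in> carrier M" "u l z \<notin> p"
  shows "indep_at p (insert k (J - {l})) (x(k := z))"
proof -
  interpret p: primeideal p R by fact
  define v where "v j = (if j = k then u l else comb (u l z) (u j) (u j z) (u l))" for j
  note D = dual_atD[OF d]
  have vj: "v j \<in> E \<and> v j z \<in> p \<and> v j (x j) \<notin> p \<and> (\<forall>i\<in>J - {l} - {j}. v j (x i) \<in> p)"
    if j: "j \<in> J - {l}" for j
  proof -
    have j': "j \<in> J" "j \<noteq> l" "j \<noteq> k" using j k by auto
    have v: "v j = comb (u l z) (u j) (u j z) (u l)" using j' by (simp add: v_def)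
    have "v j \<in> E" unfolding v using j' l z D by (intro comb_in) auto
    moreover have "v j z \<in> p"
    proof -
      have c: "u j z \<in> carrier R" "u l z \<in> carrier R" using j' l z D by auto
      then have "u l z \<otimes> u j z \<ominus> u j z \<otimes> u l z = \<zero>"
        by algebra
      then show ?thesis unfolding v using z by simp
    qed
    moreover have "v j (x j) \<notin> p"
    proof -
      have "u l (x j) \<in> p" using D(4)[OF l, of j] j' by simp
      then show ?thesis
        unfolding v using j' l z D
        by (simp add: p.minus_notin p.mult_notin p.I_l_closed)
    qed
    moreover have "v j (x i) \<in> p" if i: "i \<in> J - {l} - {j}" for i
    proof -
      have "u l (x i) \<in> p" "u j (x i) \<in> p" using D(4)[OF l, of i] D(4)[of j i] j' i by auto
      then show ?thesis
        unfolding v using j' l z D i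
        by (auto intro!: p.minus_in p.I_l_closed)
    qed
    ultimately show ?thesis by blast
  qed
  have "dual_at p (insert k (J - {l})) (x(k := z)) v"
    unfolding dual_at_def
  proof (intro ballI)
    fix j assume j: "j \<in> insert k (J - {l})"
    show "v j \<in> E \<and> (x(k := z)) j \<in> carrier M \<and> v j ((x(k := z)) j) \<notin> p \<and>
      (\<forall>i\<in>insert k (J - {l}) - {j}. v j ((x(k := z)) i) \<in> p)"
    proof (cases "j = k")
      case True
      then show ?thesis
        using D(1,2,4)[OF l] z k by (auto simp: v_def)
    next
      case False
      then have "j \<in> J - {l}" using j by auto
      then show ?thesis using vj[of j] False D k by auto
    qed
  qed
  then show ?thesis unfolding indep_at_def by blast
qed

lemma card_exchange: "finite J \<Longrightarrow> l \<in> J \<Longrightarrow> k \<notin> J - {l} \<Longrightarrow> card (insert k (J - {l})) = card J"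
  by (simp add: card_insert_if) (metis card_gt_0_iff empty_iff Suc_pred One_nat_def)

text \<open>Asking for exactly \<open>n\<close> independent vectors bounds the rank from below,
  since subfamilies of independent families are independent.\<close>

definition rank_ge :: "'a set \<Rightarrow> nat \<Rightarrow> (nat \<Rightarrow> 'm) \<Rightarrow> nat \<Rightarrow> bool" where
  "rank_ge p s x n \<longleftrightarrow> (\<exists>J \<subseteq> {..<s}. card J = n \<and> indep_at p J x)"

lemma rank_ge_le: "rank_ge p s x n \<Longrightarrow> n \<le> s"
  unfolding rank_ge_def by (metis card_lessThan card_mono finite_lessThan)

text \<open>An elementary operation keeps the span. The set of chosen indices may have to change,
  though: if \<open>j\<close> is chosen and \<open>l\<close> is not, the new vector can become
  dependent on the others, and then \<open>l\<close> takes its place.\<close>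

lemma rank_ge_addition:
  assumes p: "primeideal p R" and r: "rank_ge p s x n"
    and jl: "j < s" "l < s" "j \<noteq> l" and x: "\<And>k. k < s \<Longrightarrow> x k \<in> carrier M" and a: "a \<in> carrier R"
  shows "rank_ge p s (x(j := x j \<oplus>\<^bsub>M\<^esub> a \<odot>\<^bsub>M\<^esub> x l)) n"
proof -
  interpret p: primeideal p R by fact
  obtain J u where J: "J \<subseteq> {..<s}" "card J = n" and d: "dual_at p J x u"
    using r unfolding rank_ge_def indep_at_def by blast
  note D = dual_atD[OF d]
  have fJ: "finite J" using J finite_subset by blast
  let ?z = "x j \<oplus>\<^bsub>M\<^esub> a \<odot>\<^bsub>M\<^esub> x l"
  let ?x = "x(j := ?z)"
  have xc: "x j \<in> carrier M" "x l \<in> carrier M" "?z \<in> carrier M" using x jl a by auto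
  have fz: "f ?z = f (x j) \<oplus> a \<otimes> f (x l)" if "f \<in> E" for f
    using that xc a by (simp add: form_add form_smult)
  consider "j \<notin> J" | "j \<in> J" "l \<in> J" | "j \<in> J" "l \<notin> J" "u j ?z \<notin> p"
    | "j \<in> J" "l \<notin> J" "u j ?z \<in> p" by blast
  then have "\<exists>K \<subseteq> {..<s}. card K = n \<and> indep_at p K ?x"
  proof cases
    case 1
    then have "indep_at p J ?x"
      using d by (intro indep_at_cong[of p J x ?x]) (auto simp: indep_at_def)
    then show ?thesis using J by blast
  next
    case 2
    \<comment> \<open>Modulo \<open>p\<close>, at the new vector \<open>u l\<close> takes the value
      \<open>a \<otimes> u l (x l)\<close> and \<open>u j\<close> the value
      \<open>u j (x j)\<close>; the combination cancels them.\<close>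
    define v where "v = u(l := comb (u j (x j)) (u l) (a \<otimes> u l (x l)) (u j))"
    have ul: "u l \<in> E" "u j \<in> E" using D 2 by auto
    have c: "u j (x j) \<in> carrier R" "u l (x l) \<in> carrier R" "u j (x l) \<in> carrier R"
      "u l (x j) \<in> carrier R" using ul xc by auto
    have h: "u j (x l) \<in> p" "u l (x j) \<in> p" using D(4) 2 jl by auto
    have "v l ?z = u j (x j) \<otimes> u l (x j) \<ominus> a \<otimes> u l (x l) \<otimes> (a \<otimes> u j (x l))"
    proof -
      have "v l ?z = u j (x j) \<otimes> (u l (x j) \<oplus> a \<otimes> u l (x l)) 
        \<ominus> (a \<otimes> u l (x l)) \<otimes> (u j (x j) \<oplus> a \<otimes> u j (x l))"
        using xc ul by (simp add: v_def fz)
      also have "\<dots> = u j (x j) \<otimes> u l (x j) \<ominus> a \<otimes> u l (x l) \<otimes> (a \<otimes> u j (x l))"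
        using c a by algebra
      finally show ?thesis .
    qed
    then have vz: "v l ?z \<in> p"
      using h c a by (auto intro!: p.minus_in p.I_l_closed)
    have vl: "v l (x l) \<notin> p"
      using h c a xc D(3)[OF 2(1)] D(3)[OF 2(2)]
      by (simp add: v_def p.minus_notin p.mult_notin p.I_l_closed)
    have vE: "v l \<in> E" unfolding v_def using c a ul by (auto intro!: comb_in)
    have vo: "v l (x i) \<in> p" if "i \<in> J" "i \<noteq> l" "i \<noteq> j" for i
      using D(2,4) 2 that c a ul
      by (auto simp: v_def intro!: p.minus_in p.I_l_closed)
    have jz: "u j ?z \<notin> p"
    proof
      assume "u j ?z \<in> p"
      then have "u j ?z \<ominus> a \<otimes> u j (x l) \<in> p"
        using h a by (auto intro!: p.minus_in p.I_l_closed)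
      moreover have "u j ?z \<ominus> a \<otimes> u j (x l) = u j (x j)"
        unfolding fz[OF ul(2)] using c a by algebra
      ultimately show False using D(3)[OF 2(1)] by simp
    qed
    have oz: "u i ?z \<in> p" if "i \<in> J" "i \<noteq> l" "i \<noteq> j" for i
      using D(1,4) that 2 a by (auto simp: fz intro!: p.a_closed p.I_l_closed)
    have "dual_at p J ?x v"
      unfolding dual_at_def
    proof (intro ballI)
      fix k assume k: "k \<in> J"
      consider "k = l" | "k = j" | "k \<noteq> l" "k \<noteq> j" by blast
      then show "v k \<in> E \<and> ?x k \<in> carrier M \<and> v k (?x k) \<notin> p \<and> (\<forall>i\<in>J - {k}. v k (?x i) \<in> p)"
      proof cases
        case 1
        then show ?thesis using vE xc vl vo vz jl by auto
      next
        assume k2: "k = j"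
        then have "v k = u j" using jl by (simp add: v_def)
        then show ?thesis using k2 jz xc D 2 by auto
      next
        assume k2: "k \<noteq> l" "k \<noteq> j"
        then have "v k = u k" by (simp add: v_def)
        then show ?thesis using k2 oz D k by auto
      qed
    qed
    then show ?thesis using J unfolding indep_at_def by blast
  next
    case 3
    have "indep_at p (insert j (J - {j})) ?x"
      using 3 xc by (intro indep_at_exchange[OF p d]) auto
    then show ?thesis using J 3 by (auto simp: insert_absorb)
  next
    case 4
    have ul: "u j \<in> E" using D 4 by auto
    have c: "u j (x j) \<in> carrier R" "u j (x l) \<in> carrier R" using ul xc by auto
    \<comment> \<open>Modulo \<open>p\<close>, the form \<open>u j\<close> is nonzero at
      \<open>x j\<close> but zero at the sum, so it detects \<open>x l\<close>, which can therefore
      replace \<open>x j\<close>.\<close>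
    have "u j (x l) \<notin> p"
    proof
      assume "u j (x l) \<in> p"
      then have "u j ?z \<ominus> a \<otimes> u j (x l) \<in> p"
        using 4 a by (auto intro!: p.minus_in p.I_l_closed)
      moreover have "u j ?z \<ominus> a \<otimes> u j (x l) = u j (x j)"
        unfolding fz[OF ul] using c a by algebra
      ultimately show False using D(3)[OF 4(1)] by simp
    qed
    then have "indep_at p (insert l (J - {j})) (x(l := x l))"
      using 4 xc by (intro indep_at_exchange[OF p d]) auto
    then have "indep_at p (insert l (J - {j})) ?x"
      using jl by (intro indep_at_cong[of p "insert l (J - {j})" "x(l := x l)" ?x]) auto
    then show ?thesis using J jl card_exchange[OF fJ 4(1), of l] 4 by (intro exI[of _ "insert l (J - {j})"]) auto
  qed
  then show ?thesis unfolding rank_ge_def .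
qed

lemma rank_ge_drop:
  assumes "rank_ge p (Suc l) x n"
  obtains m where "rank_ge p l x m" "n \<le> Suc m"
proof -
  obtain J where J: "J \<subseteq> {..<Suc l}" "card J = n" "indep_at p J x"
    using assms unfolding rank_ge_def by blast
  have "J - {l} \<subseteq> {..<l}" using J by auto
  moreover have "indep_at p (J - {l}) x" using J indep_at_mono by blast
  moreover have "card J \<le> Suc (card (J - {l}))"
    by (metis Suc_pred card_Diff_singleton_if le_SucI not_gr_zero order_refl le0 One_nat_def)
  ultimately show thesis using that J unfolding rank_ge_def by blast
qed

text \<open>If fewer than all vectors are independent at \<open>p\<close>, the last one can be
  absorbed into one of the others without loss of rank; the scalar \<open>r\<close> keeps the change
  invisible at primes that contain \<open>r\<close>.\<close>
lemma rank_ge_absorb: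
  assumes p: "primeideal p R" and r: "rank_ge p (Suc l) x n" "n \<le> l"
    and x: "\<And>k. k \<le> l \<Longrightarrow> x k \<in> carrier M" and t: "t \<in> carrier R" "t \<notin> p"
  obtains "rank_ge p l x n"
    | k where "k < l" "rank_ge p l (x(k := x k \<oplus>\<^bsub>M\<^esub> t \<odot>\<^bsub>M\<^esub> x l)) n"
proof -
  interpret p: primeideal p R by fact
  obtain J u where J: "J \<subseteq> {..<Suc l}" "card J = n" and d: "dual_at p J x u"
    using r unfolding rank_ge_def indep_at_def by blast
  note D = dual_atD[OF d]
  have fJ: "finite J" using J finite_subset by blast
  show thesis
  proof (cases "l \<in> J")
    case False
    then have "J \<subseteq> {..<l}" using J(1) unfolding lessThan_Suc by blast
    moreover have "indep_at p J x" using d unfolding indep_at_def by blast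
    ultimately have "rank_ge p l x n" using J(2) unfolding rank_ge_def by blast
    then show ?thesis by (rule that(1))
  next
    case True
    \<comment> \<open>Because \<open>n \<le> l\<close>, some index is unoccupied and can take over
      the role of \<open>l\<close>.\<close>
    have "\<not> {..<Suc l} \<subseteq> J"
    proof
      assume "{..<Suc l} \<subseteq> J"
      then have "Suc l \<le> card J" using card_mono[OF fJ] by (metis card_lessThan)
      then show False using J r by simp
    qed
    then obtain k where k: "k < l" "k \<notin> J" using True unfolding lessThan_Suc by auto
    have sub: "insert k (J - {l}) \<subseteq> {..<l}" using J(1) k(1) unfolding lessThan_Suc by auto
    have cd: "card (insert k (J - {l})) = n" using card_exchange[OF fJ True, of k] k J by simp
    have xc: "x k \<in> carrier M" "x l \<in> carrier M" using x k by auto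
    have ul: "u l \<in> E" "u l (x l) \<notin> p" using D True by auto
    show ?thesis
    \<comment> \<open>If \<open>u l\<close> detects \<open>x k\<close>, then \<open>x k\<close>
      replaces the last vector as it stands. Otherwise adding \<open>t\<close> times the last vector
      gives it the value \<open>t \<otimes> u l (x l)\<close> modulo \<open>p\<close>, which is
      nonzero.\<close>
    proof (cases "u l (x k) \<in> p")
      case False
      then have "indep_at p (insert k (J - {l})) (x(k := x k))"
        using True k xc by (intro indep_at_exchange[OF p d]) auto
      then have "indep_at p (insert k (J - {l})) x" by simp
      then have "rank_ge p l x n" using sub cd unfolding rank_ge_def by blast
      then show ?thesis by (rule that(1))
    next
      case kp: True
      let ?z = "x k \<oplus>\<^bsub>M\<^esub> t \<odot>\<^bsub>M\<^esub> x l"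
      have "u l ?z \<notin> p"
      proof
        assume "u l ?z \<in> p"
        then have "u l ?z \<ominus> u l (x k) \<in> p" using kp by (rule p.minus_in)
        moreover have "u l ?z \<ominus> u l (x k) = t \<otimes> u l (x l)"
        proof -
          have "u l (x k) \<in> carrier R" "u l (x l) \<in> carrier R" using ul xc by auto
          moreover have "u l ?z = u l (x k) \<oplus> t \<otimes> u l (x l)"
            using xc t ul by (simp add: form_add form_smult)
          ultimately show ?thesis using t(1) by simp algebra
        qed
        ultimately show False using p.mult_notin t ul xc by auto
      qed
      then have "indep_at p (insert k (J - {l})) (x(k := ?z))"
        using True k xc t by (intro indep_at_exchange[OF p d]) auto
      then have "rank_ge p l (x(k := ?z)) n" using sub cd unfolding rank_ge_def by blast
      then show ?thesis by (rule that(2)[OF k(1)])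
    qed
  qed
qed

end

section \<open>Finitely many critical primes\<close>

text \<open>The ascending chain condition in the form that Noetherian induction uses, larger ideals
  coming first. The union of a strictly increasing sequence would be one of its members.\<close>

lemma (in noetherian_ring) wf_ideal_supset: "wf {(J, I). ideal I R \<and> ideal J R \<and> I \<subset> J}"
proof (unfold wf_iff_no_infinite_down_chain, intro notI, elim exE)
  fix f assume "\<forall>i. (f (Suc i), f i) \<in> {(J, I). ideal I R \<and> ideal J R \<and> I \<subset> J}"
  then have f: "\<And>i. ideal (f i) R" "\<And>i. f i \<subset> f (Suc i)" by auto
  have mono: "i \<le> j \<Longrightarrow> f i \<subseteq> f j" for i j
    using lift_Suc_mono_le[of f] f(2) by blast
  have "subset.chain {I. ideal I R} (range f)"
    unfolding subset_chain_def using f(1) mono nat_le_linear by blast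
  then have "\<Union>(range f) \<in> range f"
    by (intro ideal_chain_is_trivial) auto
  then obtain i where "\<Union>(range f) = f i" by auto
  then show False using f(2)[of i] by blast
qed

lemma (in noetherian_ring) maximalideal_above:
  assumes "ideal I R" "I \<noteq> carrier R"
  obtains m where "maximalideal m R" "I \<subseteq> m"
proof -
  obtain m where m: "m \<in> {J. ideal J R \<and> I \<subseteq> J \<and> J \<noteq> carrier R}"
    and min: "\<And>y. (y, m) \<in> {(J, I). ideal I R \<and> ideal J R \<and> I \<subset> J} \<Longrightarrow>
        y \<notin> {J. ideal J R \<and> I \<subseteq> J \<and> J \<noteq> carrier R}"
    by (rule wfE_min[OF wf_ideal_supset, of I "{J. ideal J R \<and> I \<subseteq> J \<and> J \<noteq> carrier R}"])
      (use assms in auto)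
  have "maximalideal m R"
    using m min by (intro maximalidealI) auto
  then show ?thesis using that m by blast
qed

text \<open>The witness is the product of the \<open>d k\<close>. It serves both to find a scalar
  that lies in given other primes and to keep finitely many diagonal entries nonzero at
  once.\<close>

lemma (in primeideal) common_multiple_notin:
  assumes "finite J" "\<And>k. k \<in> J \<Longrightarrow> d k \<in> carrier R - I"
  obtains c where "c \<in> carrier R" "c \<notin> I" "\<And>k p. ideal p R \<Longrightarrow> k \<in> J \<Longrightarrow> d k \<in> p \<Longrightarrow> c \<in> p"
proof -
  have "\<exists>c\<in>carrier R. c \<notin> I \<and> (\<forall>p k. ideal p R \<longrightarrow> k \<in> J \<longrightarrow> d k \<in> p \<longrightarrow> c \<in> p)"
    using assms
  proof (induction J rule: finite_induct)
    case empty
    then show ?case using one_notin by blast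
  next
    case (insert a J)
    then obtain c where c: "c \<in> carrier R" "c \<notin> I" "\<forall>p k. ideal p R \<longrightarrow> k \<in> J \<longrightarrow> d k \<in> p \<longrightarrow> c \<in> p"
      by auto
    have da: "d a \<in> carrier R" "d a \<notin> I" using insert by auto
    have "d a \<otimes> c \<in> p" if "ideal p R" "k \<in> insert a J" "d k \<in> p" for p k
      using that c da ideal.I_l_closed[of p R c "d a"] ideal.I_r_closed[of p R "d a" c] by auto
    then show ?case using da c mult_notin by (intro bexI[of _ "d a \<otimes> c"]) auto
  qed
  then show ?thesis using that by blast
qed

lemma (in cring) maximalideal_in_j_spec: "maximalideal m R \<Longrightarrow> m \<in> j_spec R"
  unfolding j_spec_def using maximalideal_prime[of m] by (auto intro!: exI[of _ "{m}"])

text \<open>Putting \<open>q\<close> in front of a chain from \<open>p\<close> gives a chain from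
  \<open>q\<close> that is longer by one, so a rank that just suffices at \<open>q\<close> has one
  to spare at the larger prime \<open>p\<close>. Finiteness of the dimensions is forced by the bound
  \<open>n\<close>.\<close>

lemma dim_in_less:
  assumes "q \<in> S" "q \<subset> p" "enat i + dim_in S q \<le> enat n" "p \<in> S"
  shows "enat (Suc i) + dim_in S p \<le> enat n"
proof -
  have len: "i + Suc k \<le> n"
    if c: "c 0 = p" "\<forall>j\<le>k. c j \<in> S" "\<forall>j<k. c j \<subset> c (Suc j)" for c k
  proof -
    define c' where "c' j = (case j of 0 \<Rightarrow> q | Suc j \<Rightarrow> c j)" for j
    have "c' 0 = q \<and> (\<forall>j\<le>Suc k. c' j \<in> S) \<and> (\<forall>j<Suc k. c' j \<subset> c' (Suc j))"
      using c assms by (auto simp: c'_def split: nat.splits)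
    then have "enat (Suc k) \<le> dim_in S q"
      unfolding dim_in_def by (intro SUP_upper) blast
    then have "enat i + enat (Suc k) \<le> enat n"
      by (rule order_trans[OF add_left_mono assms(3)])
    then show ?thesis by simp
  qed
  \<comment> \<open>The chain of length 0 ensures that the truncated subtraction
    \<open>n - Suc i\<close> below is a genuine one.\<close>
  have "Suc i \<le> n" using len[of "\<lambda>_. p" 0] assms(4) by simp
  moreover have "dim_in S p \<le> enat (n - Suc i)"
    unfolding dim_in_def
  proof (rule SUP_least)
    fix k assume "k \<in> {k. \<exists>c. c 0 = p \<and> (\<forall>j\<le>k. c j \<in> S) \<and> (\<forall>j<k. c j \<subset> c (Suc j))}"
    then have "i + Suc k \<le> n" using len by blast
    then show "enat k \<le> enat (n - Suc i)" by simp
  qed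
  ultimately show ?thesis
    using add_left_mono[of "dim_in S p" "enat (n - Suc i)" "enat (Suc i)"] by simp
qed

section \<open>Changing a family with several primes in view\<close>

context form_space
begin

text \<open>Since \<open>t\<close> lies in \<open>p\<close>, every form takes the same value modulo
  \<open>p\<close> at the old and the new vector, so the same dual forms work.\<close>

lemma indep_at_fun_upd_cong:
  assumes p: "primeideal p R" and i: "indep_at p J x"
    and t: "t \<in> p" and z: "z \<in> carrier M" and xk: "x k \<in> carrier M"
  shows "indep_at p J (x(k := x k \<oplus>\<^bsub>M\<^esub> t \<odot>\<^bsub>M\<^esub> z))"
proof -
  interpret p: primeideal p R by fact
  obtain u where d: "dual_at p J x u" using i unfolding indep_at_def by blast
  note D = dual_atD[OF d]
  have tc: "t \<in> carrier R" using t p.Icarr by blast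
  let ?z = "x k \<oplus>\<^bsub>M\<^esub> t \<odot>\<^bsub>M\<^esub> z"
  have uz: "u j ?z \<in> p \<longleftrightarrow> u j (x k) \<in> p" if j: "j \<in> J" for j
  proof -
    have uj: "u j \<in> E" using D j by auto
    have c: "u j (x k) \<in> carrier R" "u j z \<in> carrier R" using uj z xk by auto
    have tz: "t \<otimes> u j z \<in> p" using t c by (intro p.I_r_closed)
    have e: "u j ?z = u j (x k) \<oplus> t \<otimes> u j z"
      using uj z xk tc by (simp add: form_add form_smult)
    have "u j ?z \<ominus> t \<otimes> u j z = u j (x k)"
      unfolding e using c tc by algebra
    then show ?thesis using p.minus_in[OF _ tz, of "u j ?z"] e tz p.a_closed by metis
  qed
  have "dual_at p J (x(k := ?z)) u"
    unfolding dual_at_def using D uz z xk tc by auto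
  then show ?thesis unfolding indep_at_def by blast
qed

text \<open>Only multiples of the last vector are added to other vectors, so the rank of all
  \<open>Suc l\<close> vectors is kept at every prime and not just on \<open>C\<close>; this is what
  serves the noncritical primes later. On \<open>C\<close> the rank is moved into the first
  \<open>l\<close> vectors.\<close>

lemma rank_ge_avoid:
  assumes "finite C" and N: "submodule N R M"
    and "\<And>p. p \<in> C \<Longrightarrow> primeideal p R \<and> rk p \<le> l \<and> rank_ge p (Suc l) x (rk p)"
    and x: "\<And>k. k \<le> l \<Longrightarrow> x k \<in> N"
  shows "\<exists>y. (\<forall>k\<le>l. y k \<in> N) \<and>
      (\<forall>p n. primeideal p R \<longrightarrow> rank_ge p (Suc l) x n \<longrightarrow> rank_ge p (Suc l) y n) \<and>
      (\<forall>p\<in>C. rank_ge p l y (rk p))"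
  using assms(1,3)
proof (induction C rule: finite_psubset_induct)
  case (psubset C)
  note NE = submoduleE[OF N]
  show ?case
  proof (cases "C = {}")
    case True
    then show ?thesis using x by (intro exI[of _ x]) auto
  next
    case False
    text \<open>Primes are treated in decreasing order, so that each later prime contains no
      earlier one.\<close>
    obtain p where p: "p \<in> C" and min: "\<forall>q\<in>C. q \<subseteq> p \<longrightarrow> p = q"
      using finite_has_minimal[OF psubset(1) False] by blast
    have pp: "primeideal p R" and pr: "rk p \<le> l" "rank_ge p (Suc l) x (rk p)"
      using psubset(3)[OF p] by auto
    interpret p: primeideal p R by fact
    obtain y where yN: "\<And>k. k \<le> l \<Longrightarrow> y k \<in> N"
      and yr: "\<And>p n. primeideal p R \<Longrightarrow> rank_ge p (Suc l) x n \<Longrightarrow> rank_ge p (Suc l) y n"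
      and yC: "\<And>q. q \<in> C - {p} \<Longrightarrow> rank_ge q l y (rk q)"
    proof -
      have "C - {p} \<subset> C" using p by blast
      then have "\<exists>y. (\<forall>k\<le>l. y k \<in> N) \<and>
        (\<forall>p n. primeideal p R \<longrightarrow> rank_ge p (Suc l) x n \<longrightarrow> rank_ge p (Suc l) y n) \<and>
        (\<forall>q\<in>C - {p}. rank_ge q l y (rk q))"
        by (rule psubset(2)) (use psubset(3) in simp)
      then show ?thesis using that by metis
    qed
    have yc: "y k \<in> carrier M" if "k \<le> l" for k using yN NE(1) that by blast
    \<comment> \<open>By minimality no other prime of \<open>C\<close> lies inside \<open>p\<close>.
      Elements witnessing this combine to a scalar \<open>t\<close> that lies in all other primes of
      \<open>C\<close> but not in \<open>p\<close>, so among these primes a multiple by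
      \<open>t\<close> is felt at \<open>p\<close> only.\<close>
    have "\<exists>d. d \<in> carrier R - p \<and> d \<in> q" if "q \<in> C - {p}" for q
    proof -
      have "primeideal q R" using that psubset(3)[of q] by simp
      then have "q \<subseteq> carrier R" using ideal.Icarr[OF primeideal.axioms(1), of q R] by blast
      moreover have "\<not> q \<subseteq> p" using that min by blast
      ultimately show ?thesis by blast
    qed
    then obtain d where d: "\<And>q. q \<in> C - {p} \<Longrightarrow> d q \<in> carrier R - p \<and> d q \<in> q" by metis
    obtain t where t: "t \<in> carrier R" "t \<notin> p" "\<And>k q. ideal q R \<Longrightarrow> k \<in> C - {p} \<Longrightarrow> d k \<in> q \<Longrightarrow> t \<in> q"
      using p.common_multiple_notin[of "C - {p}" d] d finite_Diff[OF psubset(1)] by blast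
    have tq: "t \<in> q" if "q \<in> C - {p}" for q
      using t(3)[of q q] d[OF that] that psubset(3)[of q] primeideal.axioms(1)[of q R] by simp
    show ?thesis
    proof (rule rank_ge_absorb[OF pp yr[OF pp pr(2)] pr(1) yc t(1,2)])
      assume "rank_ge p l y (rk p)"
      then show ?thesis using yN yr yC by (intro exI[of _ y]) blast
    next
      fix k assume k: "k < l" and r: "rank_ge p l (y(k := y k \<oplus>\<^bsub>M\<^esub> t \<odot>\<^bsub>M\<^esub> y l)) (rk p)"
      let ?y = "y(k := y k \<oplus>\<^bsub>M\<^esub> t \<odot>\<^bsub>M\<^esub> y l)"
      have "?y j \<in> N" if "j \<le> l" for j
        using that k yN NE(4)[OF t(1) yN[of l]] NE(5) by auto
      moreover have "rank_ge q (Suc l) ?y n" if "primeideal q R" "rank_ge q (Suc l) x n" for q n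
        using rank_ge_addition[OF that(1) yr[OF that], of k l t] k yc t(1) by auto
      moreover have "rank_ge q l ?y (rk q)" if q: "q \<in> C" for q
      proof (cases "q = p")
        case False
        then have q': "q \<in> C - {p}" using q by blast
        have "primeideal q R" using psubset(3)[OF q] by simp
        then show ?thesis
          using yC[OF q'] indep_at_fun_upd_cong[of q _ y t "y l" k] tq[OF q'] yc k
          unfolding rank_ge_def by (meson less_imp_le order_refl)
      qed (use r in simp)
      ultimately show ?thesis by (intro exI[of _ ?y]) blast
    qed
  qed
qed

text \<open>The off-diagonal values of the dual forms lie in \<open>q\<close>, hence in every ideal
  above it. Only the diagonal can degenerate, and \<open>c\<close> lies in an ideal as soon as one
  diagonal value does. So the rank persists on a nonempty open part of the closed set of
  \<open>q\<close>.\<close>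

lemma rank_ge_open:
  assumes q: "primeideal q R" and r: "rank_ge q s x n"
  obtains c where "c \<in> carrier R" "c \<notin> q"
    "\<And>p. ideal p R \<Longrightarrow> q \<subseteq> p \<Longrightarrow> c \<notin> p \<Longrightarrow> rank_ge p s x n"
proof -
  interpret q: primeideal q R by fact
  obtain J u where J: "J \<subseteq> {..<s}" "card J = n" and d: "dual_at q J x u"
    using r unfolding rank_ge_def indep_at_def by blast
  note D = dual_atD[OF d]
  have fJ: "finite J" using J finite_subset by blast
  obtain c where c: "c \<in> carrier R" "c \<notin> q"
    "\<And>k p. ideal p R \<Longrightarrow> k \<in> J \<Longrightarrow> u k (x k) \<in> p \<Longrightarrow> c \<in> p"
    using q.common_multiple_notin[OF fJ, of "\<lambda>k. u k (x k)"] D by blast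
  have "rank_ge p s x n" if p: "ideal p R" "q \<subseteq> p" "c \<notin> p" for p
  proof -
    have "dual_at p J x u"
      unfolding dual_at_def using D c(3)[OF p(1)] p by blast
    then show ?thesis using J unfolding rank_ge_def indep_at_def by blast
  qed
  then show ?thesis using that c by blast
qed

text \<open>Rank at least the minimum of \<open>s\<close> and \<open>i + dim p\<close>: a condition
  that can be kept while vectors are removed down to \<open>s = i\<close>, where it means full
  rank.\<close>

definition basic_family :: "nat \<Rightarrow> nat \<Rightarrow> (nat \<Rightarrow> 'm) \<Rightarrow> 'a set \<Rightarrow> bool" where
  "basic_family i s x p \<longleftrightarrow>
     (\<exists>n. rank_ge p s x n \<and> (n = s \<or> enat i + dim_in (j_spec R) p \<le> enat n))"

text \<open>Noetherian induction on \<open>I\<close> over the critical primes above it. If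
  \<open>I\<close> is in the j-spectrum, its rank persists on an open part of its closed set, where
  the dimension is strictly smaller, so no prime there except perhaps \<open>I\<close> is critical.
  Otherwise larger ideals take over: the intersection of the maximal ideals above \<open>I\<close>
  if that is bigger, and else \<open>I\<close> enlarged by \<open>a\<close> or by \<open>b\<close>,
  where \<open>a\<close> and \<open>b\<close> witness that \<open>I\<close> is not prime.\<close>

lemma finite_critical:
  assumes noeth: "noetherian_ring R" and B: "\<And>p. p \<in> j_spec R \<Longrightarrow> basic_family i s x p"
  shows "finite {p \<in> j_spec R. \<not> basic_family (Suc i) s x p}" (is "finite ?C")
proof -
  interpret noetherian_ring R by fact
  \<comment> \<open>The closed set of \<open>I\<close> is covered by those of \<open>J1\<close> and
    \<open>J2\<close>, because a prime that contains \<open>a \<otimes> b\<close> contains a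
    factor.\<close>
  have split: "finite {p \<in> ?C. I \<subseteq> p}"
    if "J1 = Idl (insert a I)" "J2 = Idl (insert b I)" "a \<in> carrier R" "b \<in> carrier R" "ideal I R"
      "finite {p \<in> ?C. J1 \<subseteq> p}" "finite {p \<in> ?C. J2 \<subseteq> p}" "a \<otimes> b \<in> I" for I J1 J2 a b
  proof (rule finite_subset)
    show "{p \<in> ?C. I \<subseteq> p} \<subseteq> {p \<in> ?C. J1 \<subseteq> p} \<union> {p \<in> ?C. J2 \<subseteq> p}"
    proof
      fix p assume p: "p \<in> {p \<in> ?C. I \<subseteq> p}"
      then have pp: "primeideal p R" by (simp add: j_spec_def)
      have "a \<in> p \<or> b \<in> p" using primeideal.I_prime[OF pp that(3,4)] that(8) p by blast
      then show "p \<in> {p \<in> ?C. J1 \<subseteq> p} \<union> {p \<in> ?C. J2 \<subseteq> p}"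
      proof
        assume "a \<in> p"
        then have "J1 \<subseteq> p"
          unfolding that(1) using p by (intro genideal_minimal[OF primeideal.axioms(1)[OF pp]]) simp
        then show ?thesis using p by simp
      next
        assume "b \<in> p"
        then have "J2 \<subseteq> p"
          unfolding that(2) using p by (intro genideal_minimal[OF primeideal.axioms(1)[OF pp]]) simp
        then show ?thesis using p by simp
      qed
    qed
  qed (use that in simp)
  have "ideal I R \<longrightarrow> finite {p \<in> ?C. I \<subseteq> p}" for I
  proof (induction I rule: wf_induct_rule[OF wf_ideal_supset])
    case (1 I)
    show ?case
    proof
      assume I: "ideal I R"
      have IH: "finite {p \<in> ?C. J \<subseteq> p}" if "ideal J R" "I \<subset> J" for J using 1 I that by blast
      have gen: "ideal (Idl (insert a I)) R \<and> I \<subset> Idl (insert a I)" if "a \<in> carrier R" "a \<notin> I" for a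
      proof -
        have "insert a I \<subseteq> carrier R" using that ideal.Icarr[OF I] by blast
        from genideal_ideal[OF this] genideal_self[OF this] show ?thesis using that by blast
      qed
      consider "{p \<in> ?C. I \<subseteq> p} = {}" | "I \<in> j_spec R"
        | "{p \<in> ?C. I \<subseteq> p} \<noteq> {}" "I \<notin> j_spec R" by blast
      then show "finite {p \<in> ?C. I \<subseteq> p}"
      proof cases
        assume "{p \<in> ?C. I \<subseteq> p} = {}"
        then show ?thesis by (simp only: finite.emptyI)
      next
        assume q: "I \<in> j_spec R"
        then have qp: "primeideal I R" by (simp add: j_spec_def)
        obtain n where n: "rank_ge I s x n" "n = s \<or> enat i + dim_in (j_spec R) I \<le> enat n"
          using B[OF q] unfolding basic_family_def by blast
        obtain c where c: "c \<in> carrier R" "c \<notin> I"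
          and cr: "\<And>p. ideal p R \<Longrightarrow> I \<subseteq> p \<Longrightarrow> c \<notin> p \<Longrightarrow> rank_ge p s x n"
          using rank_ge_open[OF qp n(1)] by blast
        \<comment> \<open>Above \<open>I\<close> and off the zero set of \<open>c\<close> the rank
          is still \<open>n\<close>, and by \<open>dim_in_less\<close> this is enough for
          \<open>Suc i\<close>.\<close>
        have "{p \<in> ?C. I \<subseteq> p} \<subseteq> insert I {p \<in> ?C. Idl (insert c I) \<subseteq> p}"
        proof
          fix p assume p: "p \<in> {p \<in> ?C. I \<subseteq> p}"
          then have pi: "ideal p R" by (simp add: j_spec_def primeideal_def)
          show "p \<in> insert I {p \<in> ?C. Idl (insert c I) \<subseteq> p}"
          proof (cases "p = I \<or> c \<in> p")
            case True
            then show ?thesis using genideal_minimal[OF pi, of "insert c I"] p by auto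
          next
            case False
            then have "rank_ge p s x n" using cr[OF pi] p by blast
            moreover have "n = s \<or> enat (Suc i) + dim_in (j_spec R) p \<le> enat n"
              using n(2) dim_in_less[OF q, of p i n] p False by blast
            ultimately show ?thesis using p unfolding basic_family_def by blast
          qed
        qed
        then show ?thesis using IH gen[OF c] finite_subset by blast
      next
        assume ne: "{p \<in> ?C. I \<subseteq> p} \<noteq> {}" and nj: "I \<notin> j_spec R"
        \<comment> \<open>Every prime of the j-spectrum above \<open>I\<close> is an intersection of
          members of \<open>P\<close>, so passing from \<open>I\<close> to \<open>\<Inter>P\<close>
          loses no critical prime.\<close>
        define P where "P = {m. maximalideal m R \<and> I \<subseteq> m}"
        have Pm: "\<Inter>P \<subseteq> p" if "p \<in> ?C" "I \<subseteq> p" for p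
          using that unfolding P_def j_spec_def by blast
        obtain p0 where p0: "p0 \<in> ?C" "I \<subseteq> p0" using ne by blast
        then have Pne: "P \<noteq> {}" unfolding P_def j_spec_def by blast
        show ?thesis
        proof (cases "\<Inter>P = I")
          case False
          have "ideal (\<Inter>P) R" using Pne by (intro i_Intersect) (auto simp: P_def maximalideal_def)
          moreover have "I \<subset> \<Inter>P" using False unfolding P_def by blast
          ultimately have "finite {p \<in> ?C. \<Inter>P \<subseteq> p}" by (rule IH)
          then show ?thesis using Pm by (auto elim!: rev_finite_subset)
        next
          case True
          have "I \<noteq> carrier R"
          proof
            assume "I = carrier R"
            moreover have "primeideal p0 R" using p0 by (simp add: j_spec_def)
            ultimately show False
              using p0 primeideal.I_notcarr[of p0 R] ideal.Icarr[OF primeideal.axioms(1), of p0 R]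
              by blast
          qed
          then have neq: "carrier R \<noteq> I" by blast
          have np: "\<not> primeideal I R"
          proof
            assume "primeideal I R"
            moreover have "\<forall>m\<in>P. maximalideal m R" by (simp add: P_def)
            ultimately have "I \<in> j_spec R" using True Pne unfolding j_spec_def by blast
            then show False using nj by contradiction
          qed
          have "\<exists>a\<in>carrier R. \<exists>b\<in>carrier R. a \<otimes> b \<in> I \<and> a \<notin> I \<and> b \<notin> I"
          proof (rule ccontr)
            assume "\<not> ?thesis"
            then have "primeideal I R"
              by (intro primeidealI[OF I R.cring_axioms neq]) blast
            then show False using np by contradiction
          qed
          then obtain a b where ab: "a \<in> carrier R" "b \<in> carrier R" "a \<otimes> b \<in> I" "a \<notin> I" "b \<notin> I"
            by blast
          have "finite {p \<in> ?C. Idl (insert a I) \<subseteq> p}" "finite {p \<in> ?C. Idl (insert b I) \<subseteq> p}"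
            using IH gen[OF ab(1,4)] gen[OF ab(2,5)] by (simp_all only:)
          then show ?thesis
            by (rule split[OF refl refl ab(1,2) I _ _ ab(3)])
        qed
      qed
    qed
  qed
  from this[of "{\<zero>}"] have "finite {p \<in> ?C. {\<zero>} \<subseteq> p}" using zeroideal by blast
  moreover have "\<zero> \<in> p" if "p \<in> j_spec R" for p
  proof -
    have "primeideal p R" using that by (simp add: j_spec_def)
    then show ?thesis
      by (intro additive_subgroup.zero_closed ideal.axioms(1) primeideal.axioms(1))
  qed
  then have "{p \<in> ?C. {\<zero>} \<subseteq> p} = ?C" by blast
  ultimately show ?thesis by simp
qed

text \<open>A noncritical prime has full rank or one to spare, so losing a vector does no harm
  there. At the critical primes the rank itself must survive in the first \<open>l\<close> vectors;
  it is at most \<open>l\<close> there, so \<open>rank_ge_avoid\<close> applies.\<close>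

lemma basic_family_reduce:
  assumes noeth: "noetherian_ring R" and N: "submodule N R M"
    and B: "\<And>p. p \<in> j_spec R \<Longrightarrow> basic_family i (Suc l) x p" and x: "\<And>k. k \<le> l \<Longrightarrow> x k \<in> N"
  obtains y where "\<And>k. k \<le> l \<Longrightarrow> y k \<in> N" "\<And>p. p \<in> j_spec R \<Longrightarrow> basic_family i l y p"
proof -
  define C where "C = {p \<in> j_spec R. \<not> basic_family (Suc i) (Suc l) x p}"
  have fin: "finite C" unfolding C_def using finite_critical[OF noeth B] .
  have prime: "primeideal p R" if "p \<in> j_spec R" for p using that by (simp add: j_spec_def)
  have "\<exists>n. n \<le> l \<and> rank_ge p (Suc l) x n \<and> enat i + dim_in (j_spec R) p \<le> enat n"
    if "p \<in> C" for p
  proof -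
    have pj: "p \<in> j_spec R" "\<not> basic_family (Suc i) (Suc l) x p"
      using that by (auto simp: C_def)
    obtain n where n: "rank_ge p (Suc l) x n" "n = Suc l \<or> enat i + dim_in (j_spec R) p \<le> enat n"
      using B[OF pj(1)] unfolding basic_family_def by blast
    \<comment> \<open>Full rank would make the family basic for \<open>Suc i\<close> too, and
      \<open>p\<close> would not be critical.\<close>
    have "n \<noteq> Suc l" using pj(2) n(1) unfolding basic_family_def by blast
    then show ?thesis using n rank_ge_le[OF n(1)] by (intro exI[of _ n]) auto
  qed
  then obtain rk where rk: "\<And>p. p \<in> C \<Longrightarrow> rk p \<le> l \<and> rank_ge p (Suc l) x (rk p) \<and>
      enat i + dim_in (j_spec R) p \<le> enat (rk p)" by metis
  obtain y where y: "\<And>k. k \<le> l \<Longrightarrow> y k \<in> N"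
    and yr: "\<And>p n. primeideal p R \<Longrightarrow> rank_ge p (Suc l) x n \<Longrightarrow> rank_ge p (Suc l) y n"
    and yC: "\<And>p. p \<in> C \<Longrightarrow> rank_ge p l y (rk p)"
    using rank_ge_avoid[OF fin N, of rk l x] rk x prime unfolding C_def by blast
  have "basic_family i l y p" if p: "p \<in> j_spec R" for p
  proof (cases "p \<in> C")
    case True
    then show ?thesis using rk yC unfolding basic_family_def by blast
  next
    case False
    then obtain n where n: "rank_ge p (Suc l) x n"
      "n = Suc l \<or> enat (Suc i) + dim_in (j_spec R) p \<le> enat n"
      using p unfolding C_def basic_family_def by blast
    obtain m where m: "rank_ge p l y m" "n \<le> Suc m"
      using rank_ge_drop[OF yr[OF prime[OF p] n(1)]] .
    have "m = l \<or> enat i + dim_in (j_spec R) p \<le> enat m"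
    proof (cases "n = Suc l")
      case True
      then show ?thesis using m rank_ge_le[OF m(1)] by simp
    next
      case False
      then have "enat (Suc i) + dim_in (j_spec R) p \<le> enat (Suc m)"
        using n(2) m(2) by (meson enat_ord_simps(1) order_trans)
      then show ?thesis by (cases "dim_in (j_spec R) p") auto
    qed
    then show ?thesis using m(1) unfolding basic_family_def by blast
  qed
  then show ?thesis using that y by blast
qed

end

section \<open>From local rank to a global summand\<close>

context form_space
begin

text \<open>The sum is taken in \<open>N\<close> as a module of its own, where its finite generation
  is stated; hence membership in \<open>N\<close> is carried through the induction.\<close>

lemma form_generators:
  assumes u: "u \<in> E" and N: "submodule N R M" and I: "ideal I R"
    and A: "finite A" "A \<subseteq> N"
    and y: "y = finsum (M\<lparr>carrier := N\<rparr>) (\<lambda>a. c a \<odot>\<^bsub>M\<^esub> a) A" "c \<in> A \<rightarrow> carrier R"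
    and all: "\<And>a. a \<in> A \<Longrightarrow> u a \<in> I"
  shows "u y \<in> I"
proof -
  interpret N: module R "M\<lparr>carrier := N\<rparr>"
    using submodule.submodule_is_module[OF N module_axioms] .
  interpret I: ideal I R by fact
  note NE = submoduleE[OF N]
  have "finsum (M\<lparr>carrier := N\<rparr>) (\<lambda>a. c a \<odot>\<^bsub>M\<^esub> a) B \<in> N \<and>
      u (finsum (M\<lparr>carrier := N\<rparr>) (\<lambda>a. c a \<odot>\<^bsub>M\<^esub> a) B) \<in> I" if "B \<subseteq> A" for B
    using finite_subset[OF that A(1)] that
  proof (induction B rule: finite_induct)
    case empty
    then show ?case
      using N.zero_closed form_zero[OF u] by (simp add: N.finsum_empty)
  next
    case (insert b B)
    let ?f = "\<lambda>a. c a \<odot>\<^bsub>M\<^esub> a"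
    let ?s = "finsum (M\<lparr>carrier := N\<rparr>) ?f B"
    have cl: "?f a \<in> N" if "a \<in> A" for a
      using that A(2) y(2) NE(4) by auto
    have IH: "?s \<in> N" "u ?s \<in> I" using insert by auto
    have b: "b \<in> A" "c b \<in> carrier R" "b \<in> N" "?f b \<in> N"
      using insert(4) y(2) A(2) cl by auto
    have "finsum (M\<lparr>carrier := N\<rparr>) ?f (insert b B) = ?f b \<oplus>\<^bsub>M\<^esub> ?s"
    proof -
      have "?f \<in> B \<rightarrow> carrier (M\<lparr>carrier := N\<rparr>)" using insert(4) cl by auto
      from N.finsum_insert[OF insert(1,2) this] show ?thesis using b(4) by simp
    qed
    moreover have "u (?f b \<oplus>\<^bsub>M\<^esub> ?s) = c b \<otimes> u b \<oplus> u ?s"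
      using subsetD[OF NE(1)] b IH(1) u by (simp add: form_add form_smult)
    moreover have "c b \<otimes> u b \<in> I" using all[OF b(1)] b(2) by (rule I.I_l_closed)
    ultimately show ?case using IH b NE(5) I.a_closed by simp
  qed
  then show ?thesis using y by blast
qed

text \<open>A form that is nonzero modulo \<open>p\<close> at a vector of \<open>N\<close> is
  nonzero modulo \<open>p\<close> at some generator, which can be exchanged for that vector.
  \<open>K\<close> collects the positions already exchanged. In this way the local ranks, found with
  different vectors at each prime, are all realised in one finite family.\<close>

lemma indep_at_generators:
  assumes p: "primeideal p R" and N: "submodule N R M" and A: "finite A" "A \<subseteq> N"
    and gen: "\<And>y. y \<in> N \<Longrightarrow> \<exists>c\<in>A \<rightarrow> carrier R. y = finsum (M\<lparr>carrier := N\<rparr>) (\<lambda>a. c a \<odot>\<^bsub>M\<^esub> a) A"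
    and x: "indep_at p J x" "finite J" "x ` J \<subseteq> N"
  obtains y where "indep_at p J y" "y ` J \<subseteq> A"
proof -
  have NM: "N \<subseteq> carrier M" using submoduleE(1)[OF N] .
  have ip: "ideal p R" using p by (rule primeideal.axioms)
  have "\<exists>y. indep_at p J y \<and> y ` J \<subseteq> N \<and> y ` K \<subseteq> A" if "K \<subseteq> J" for K
    using finite_subset[OF that x(2)] that
  proof (induction K rule: finite_induct)
    case empty
    show ?case using x(1,3) by (intro exI[of _ x]) simp
  next
    case (insert k K)
    then obtain y where y: "indep_at p J y" "y ` J \<subseteq> N" "y ` K \<subseteq> A" by auto
    then obtain u where d: "dual_at p J y u" unfolding indep_at_def by blast
    have kJ: "k \<in> J" using insert by simp
    note D = dual_atD[OF d kJ]
    have "\<exists>a\<in>A. u k a \<notin> p"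
    proof (rule ccontr)
      assume "\<not> ?thesis"
      moreover obtain c where c: "c \<in> A \<rightarrow> carrier R"
        "y k = finsum (M\<lparr>carrier := N\<rparr>) (\<lambda>a. c a \<odot>\<^bsub>M\<^esub> a) A"
        using gen[of "y k"] y(2) kJ by blast
      ultimately have "u k (y k) \<in> p"
        using form_generators[OF D(1) N ip A c(2,1)] by blast
      then show False using D(3) by simp
    qed
    then obtain a where a: "a \<in> A" "u k a \<notin> p" by blast
    have "indep_at p (insert k (J - {k})) (y(k := a))"
      using a A(2) NM kJ by (intro indep_at_exchange[OF p d]) auto
    then have "indep_at p J (y(k := a))" using kJ by (simp add: insert_absorb)
    then show ?case
    proof (intro exI conjI)
      show "y(k := a) ` J \<subseteq> N" "y(k := a) ` insert k K \<subseteq> A" using y(2,3) a(1) A(2) by auto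
    qed
  qed
  from this[OF order_refl] show ?thesis using that by blast
qed

text \<open>Independence forces \<open>g\<close> to be injective: a vector used twice would have its
  dual form both inside and outside \<open>p\<close>.\<close>

lemma indep_at_reindex:
  assumes "indep_at p J y" "\<And>k. k \<in> J \<Longrightarrow> g k \<in> I \<and> h (g k) = y k"
  shows "\<exists>K \<subseteq> I. card K = card J \<and> indep_at p K h"
proof -
  obtain u where d: "dual_at p J y u" using assms(1) unfolding indep_at_def by blast
  note D = dual_atD[OF d]
  have inj: "inj_on g J"
  proof (rule inj_onI, rule ccontr)
    fix j k assume jk: "j \<in> J" "k \<in> J" "g j = g k" "j \<noteq> k"
    then have "y j = y k" using assms(2)[of j] assms(2)[of k] by simp
    then show False using D(3)[OF jk(2)] D(4)[OF jk(2,1,4)] by simp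
  qed
  have "dual_at p (g ` J) h (\<lambda>i. u (inv_into J g i))"
    unfolding dual_at_def
  proof (intro ballI)
    fix i assume "i \<in> g ` J"
    then obtain k where k: "k \<in> J" "i = g k" by blast
    have "u k (h j) \<in> p" if j: "j \<in> g ` J - {g k}" for j
    proof -
      obtain l where l: "l \<in> J" "j = g l" "l \<noteq> k" using j by blast
      then show ?thesis using D(4)[OF k(1) l(1,3)] assms(2)[OF l(1)] by simp
    qed
    then show "u (inv_into J g i) \<in> E \<and> h i \<in> carrier M \<and> u (inv_into J g i) (h i) \<notin> p \<and>
        (\<forall>j\<in>g ` J - {i}. u (inv_into J g i) (h j) \<in> p)"
      using D[OF k(1)] inj assms(2)[OF k(1)] k by (simp add: inv_into_f_f)
  qed
  then show ?thesis
    using assms(2) card_image[OF inj] unfolding indep_at_def by (intro exI[of _ "g ` J"]) auto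
qed

text \<open>Fraction-free Gaussian elimination; \<open>T\<close> is the set of columns already
  cleared. Each step multiplies the other forms by the pivot \<open>v t (x t)\<close>, which is
  outside \<open>p\<close>, so the diagonal stays outside \<open>p\<close>. True zeros, rather than
  zeros modulo \<open>p\<close>, allow forms found at different maximal ideals to be
  combined.\<close>

lemma dual_at_exact:
  assumes p: "primeideal p R" and J: "finite J" and d: "dual_at p J x u"
  shows "\<exists>v. dual_at p J x v \<and> (\<forall>j\<in>J. \<forall>k\<in>J. j \<noteq> k \<longrightarrow> v k (x j) = \<zero>)"
proof -
  interpret p: primeideal p R by fact
  have "\<exists>v. dual_at p J x v \<and> (\<forall>j\<in>T. \<forall>k\<in>J. j \<noteq> k \<longrightarrow> v k (x j) = \<zero>)" if "T \<subseteq> J" for T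
    using finite_subset[OF that J] that
  proof (induction T rule: finite_induct)
    case empty
    then show ?case using d by blast
  next
    case (insert t T)
    then obtain v where v: "dual_at p J x v" "\<forall>j\<in>T. \<forall>k\<in>J. j \<noteq> k \<longrightarrow> v k (x j) = \<zero>" by auto
    note D = dual_atD[OF v(1)]
    have t: "t \<in> J" "t \<notin> T" using insert by auto
    define w where "w k = (if k = t then v t else comb (v t (x t)) (v k) (v k (x t)) (v t))" for k
    have c: "v k (x j) \<in> carrier R" if "k \<in> J" "j \<in> J" for k j using D that by blast
    have wx: "w k (x j) = v t (x t) \<otimes> v k (x j) \<ominus> v k (x t) \<otimes> v t (x j)"
      if "k \<noteq> t" "j \<in> J" for k j
      using D(2) that by (simp add: w_def)
    have "dual_at p J x w"
      unfolding dual_at_def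
    proof (intro ballI)
      fix k assume k: "k \<in> J"
      show "w k \<in> E \<and> x k \<in> carrier M \<and> w k (x k) \<notin> p \<and> (\<forall>j\<in>J - {k}. w k (x j) \<in> p)"
      proof (cases "k = t")
        case True
        then show ?thesis using D[OF k] by (auto simp: w_def)
      next
        case False
        have "w k \<in> E" using False k t c D(1) by (simp add: w_def comb_in)
        moreover have "w k (x k) \<notin> p"
        proof -
          have "v k (x t) \<otimes> v t (x k) \<in> p"
            using p.I_l_closed[OF D(4)[OF t(1) k False] c[OF k t(1)]] .
          moreover have "v t (x t) \<otimes> v k (x k) \<notin> p"
            using p.mult_notin c k t D(3) by blast
          ultimately show ?thesis
            unfolding wx[OF False k] using c k t by (intro p.minus_notin) auto
        qed
        moreover have "w k (x j) \<in> p" if j: "j \<in> J - {k}" for j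
        proof -
          have "v t (x t) \<otimes> v k (x j) \<in> p"
            using p.I_l_closed D(4)[OF k, of j] c[OF t(1) t(1)] j by blast
          moreover have "v k (x t) \<otimes> v t (x j) \<in> p"
            using p.I_r_closed D(4)[OF k t(1)] False c[OF t(1), of j] j by blast
          ultimately show ?thesis
            using wx[OF False, of j] j p.minus_in by simp
        qed
        ultimately show ?thesis using D(2)[OF k] by blast
      qed
    qed
    moreover have "w k (x j) = \<zero>" if jk: "j \<in> insert t T" "k \<in> J" "j \<noteq> k" for j k
    proof (cases "k = t")
      case True
      then show ?thesis using v(2) jk by (auto simp: w_def)
    next
      case False
      have jJ: "j \<in> J" using jk insert by auto
      show ?thesis
      proof (cases "j = t")
        case True
        have "v t (x t) \<otimes> v k (x t) \<ominus> v k (x t) \<otimes> v t (x t) = \<zero>"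
          using c[OF t(1) t(1)] c[OF jk(2) t(1)] by algebra
        then show ?thesis using wx[OF False jJ] True by simp
      next
        case jt: False
        then have "v k (x j) = \<zero>" "v t (x j) = \<zero>" using v(2) jk t by auto
        then show ?thesis using wx[OF False jJ] c jk t by (simp add: a_minus_def)
      qed
    qed
    ultimately show ?case by blast
  qed
  from this[OF order_refl] show ?thesis .
qed

section \<open>Dual bases and the summands they define\<close>

lemma form_finsum:
  assumes "f \<in> E" "finite A" "g \<in> A \<rightarrow> carrier M"
  shows "f (finsum M g A) = finsum R (\<lambda>a. f (g a)) A"
  using assms(2,3)
proof (induction A rule: finite_induct)
  case empty
  then show ?case by (simp add: form_zero assms(1))
next
  case (insert a A)
  then show ?case
    using assms(1) form_add[of f "g a" "finsum M g A"]
    by (subst M.finsum_insert, auto, subst R.finsum_insert, auto)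
qed

lemma submodule_finsum_closed:
  assumes N: "submodule N R M" and "finite A" "g \<in> A \<rightarrow> N"
  shows "finsum M g A \<in> N"
  using assms(2,3)
proof (induction A rule: finite_induct)
  case empty
  show ?case using submoduleE(2)[OF N] submoduleE(4)[OF N, of \<zero>] submoduleE(1)[OF N]
    by (metis M.finsum_empty R.zero_closed all_not_in_conv smult_l_null subsetD)
next
  case (insert a A)
  then show ?case
    using submoduleE(1,5)[OF N] by (subst M.finsum_insert) (auto simp: Pi_iff)
qed

text \<open>The map \<open>P\<close> is idempotent; the summand is its image and the complement its
  kernel. Taking the image as the fixed points of \<open>P\<close> and the kernel as the common
  zeros of the \<open>e k\<close> makes both submodules by linearity alone.\<close>

lemma free_E_summand_dual_basis:
  fixes n :: nat
  assumes N: "submodule N R M" and x: "\<And>k. k < n \<Longrightarrow> x k \<in> N"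
    and e: "\<And>k. k < n \<Longrightarrow> e k \<in> E"
    and dual: "\<And>j k. j < n \<Longrightarrow> k < n \<Longrightarrow> e k (x j) = (if j = k then \<one> else \<zero>)"
  obtains F where "free_E_summand R M E F n" "F \<subseteq> N"
proof -
  have xc: "x k \<in> carrier M" if "k < n" for k using x[OF that] submoduleE(1)[OF N] by blast
  define P where "P y = finsum M (\<lambda>k. e k y \<odot>\<^bsub>M\<^esub> x k) {..<n}" for y
  have Pc [simp]: "P y \<in> carrier M" if "y \<in> carrier M" for y
    unfolding P_def using that xc e by (intro M.finsum_closed) auto
  have coord: "e j (finsum M (\<lambda>k. c k \<odot>\<^bsub>M\<^esub> x k) {..<n}) = c j"
    if c: "c \<in> {..<n} \<rightarrow> carrier R" and j: "j < n" for c j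
  proof -
    have "e j (finsum M (\<lambda>k. c k \<odot>\<^bsub>M\<^esub> x k) {..<n}) = finsum R (\<lambda>k. e j (c k \<odot>\<^bsub>M\<^esub> x k)) {..<n}"
      using c xc by (intro form_finsum e j) auto
    also have "\<dots> = finsum R (\<lambda>k. if j = k then c k else \<zero>) {..<n}"
      using c xc e j dual by (intro R.finsum_cong') (auto simp: form_smult Pi_iff)
    also have "\<dots> = c j" using c j by (intro R.finsum_singleton) auto
    finally show ?thesis .
  qed
  have eP: "e j (P y) = e j y" if "j < n" "y \<in> carrier M" for j y
    unfolding P_def using that e by (intro coord) auto
  have Padd: "P (y \<oplus>\<^bsub>M\<^esub> z) = P y \<oplus>\<^bsub>M\<^esub> P z" if "y \<in> carrier M" "z \<in> carrier M" for y z
  proof -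
    have "P (y \<oplus>\<^bsub>M\<^esub> z) = finsum M (\<lambda>k. e k y \<odot>\<^bsub>M\<^esub> x k \<oplus>\<^bsub>M\<^esub> e k z \<odot>\<^bsub>M\<^esub> x k) {..<n}"
      unfolding P_def using that xc e
      by (intro M.finsum_cong') (auto simp: form_add smult_l_distr)
    also have "\<dots> = P y \<oplus>\<^bsub>M\<^esub> P z"
      unfolding P_def using that xc e by (intro M.finsum_addf) auto
    finally show ?thesis .
  qed
  have Psmult: "P (a \<odot>\<^bsub>M\<^esub> y) = a \<odot>\<^bsub>M\<^esub> P y" if "a \<in> carrier R" "y \<in> carrier M" for a y
    unfolding P_def using that xc e
    by (subst finsum_smult_ldistr) (auto intro!: M.finsum_cong' simp: form_smult smult_assoc1)
  have Px: "P (x j) = x j" if j: "j < n" for j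
  proof -
    have "P (x j) = finsum M (\<lambda>k. if j = k then x k else \<zero>\<^bsub>M\<^esub>) {..<n}"
      unfolding P_def using j xc dual by (intro M.finsum_cong') auto
    also have "\<dots> = x j" using j xc by (intro M.finsum_singleton) auto
    finally show ?thesis .
  qed
  define F where "F = {y \<in> carrier M. P y = y}"
  define G where "G = {y \<in> carrier M. \<forall>k<n. e k y = \<zero>}"
  have neg: "\<ominus>\<^bsub>M\<^esub> y = (\<ominus> \<one>) \<odot>\<^bsub>M\<^esub> y" if "y \<in> carrier M" for y
    using that by (simp add: smult_l_minus)
  have FM: "submodule F R M"
  proof (rule submoduleI)
    show "\<zero>\<^bsub>M\<^esub> \<in> F" using Psmult[of \<zero> "\<zero>\<^bsub>M\<^esub>"] by (simp add: F_def)
    show "\<ominus>\<^bsub>M\<^esub> y \<in> F" if "y \<in> F" for y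
      using that Psmult[of "\<ominus> \<one>" y] neg[of y] by (simp add: F_def)
  qed (auto simp: F_def Padd Psmult)
  have GM: "submodule G R M"
  proof (rule submoduleI)
    show "\<ominus>\<^bsub>M\<^esub> y \<in> G" if "y \<in> G" for y
      using that neg[of y] e by (auto simp: G_def form_smult)
  qed (auto simp: G_def form_zero form_add form_smult e)
  have PG: "y \<ominus>\<^bsub>M\<^esub> P y \<in> G" if y: "y \<in> carrier M" for y
  proof -
    have "e k (y \<ominus>\<^bsub>M\<^esub> P y) = \<zero>" if k: "k < n" for k
    proof -
      have "e k (y \<ominus>\<^bsub>M\<^esub> P y) = e k y \<oplus> (\<ominus> \<one>) \<otimes> e k (P y)"
        using y e[OF k] by (simp add: a_minus_def M.minus_eq neg form_add form_smult)
      also have "\<dots> = \<zero>" using y e[OF k] by (simp add: eP[OF k] l_minus R.r_neg)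
      finally show ?thesis .
    qed
    then show ?thesis using y by (simp add: G_def)
  qed
  have PF: "P y \<in> F" if "y \<in> carrier M" for y
  proof -
    have "P (P y) = P y"
      unfolding P_def[of "P y"] unfolding P_def[of y] 
      by (rule M.finsum_cong') (use that eP xc e P_def in auto)
    then show ?thesis using that by (simp add: F_def)
  qed
  have "F \<inter> G = {\<zero>\<^bsub>M\<^esub>}"
  proof
    show "F \<inter> G \<subseteq> {\<zero>\<^bsub>M\<^esub>}"
    proof
      fix y assume y: "y \<in> F \<inter> G"
      have "P y = finsum M (\<lambda>k. \<zero>\<^bsub>M\<^esub>) {..<n}"
        unfolding P_def using y xc by (intro M.finsum_cong') (auto simp: G_def)
      then show "y \<in> {\<zero>\<^bsub>M\<^esub>}" using y by (simp add: F_def M.finsum_zero)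
    qed
    show "{\<zero>\<^bsub>M\<^esub>} \<subseteq> F \<inter> G"
      using subgroup.one_closed[OF submodule.axioms(1)[OF FM]]
        subgroup.one_closed[OF submodule.axioms(1)[OF GM]] by simp
  qed
  moreover have "F <+>\<^bsub>M\<^esub> G = carrier M"
  proof
    show "F <+>\<^bsub>M\<^esub> G \<subseteq> carrier M" unfolding set_add_def' by (auto simp: F_def G_def)
    show "carrier M \<subseteq> F <+>\<^bsub>M\<^esub> G"
    proof
      fix y assume y: "y \<in> carrier M"
      then have "y = P y \<oplus>\<^bsub>M\<^esub> (y \<ominus>\<^bsub>M\<^esub> P y)"
        by (simp add: M.minus_eq M.a_lcomm M.r_neg)
      then show "y \<in> F <+>\<^bsub>M\<^esub> G" unfolding set_add_def' using PF[OF y] PG[OF y] by blast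
    qed
  qed
  moreover have "x \<in> {..<n} \<rightarrow> F" using xc Px by (auto simp: F_def)
  moreover have "\<forall>y\<in>F. \<exists>!c. c \<in> {..<n} \<rightarrow>\<^sub>E carrier R \<and> y = finsum M (\<lambda>k. c k \<odot>\<^bsub>M\<^esub> x k) {..<n}"
  proof
    fix y assume y: "y \<in> F"
    show "\<exists>!c. c \<in> {..<n} \<rightarrow>\<^sub>E carrier R \<and> y = finsum M (\<lambda>k. c k \<odot>\<^bsub>M\<^esub> x k) {..<n}"
    \<comment> \<open>By \<open>coord\<close>, applying \<open>e j\<close> to a combination returns
      its \<open>j\<close>-th coefficient. The witness is restricted because coefficient families
      are extensional.\<close>
    proof (rule ex1I[of _ "\<lambda>k\<in>{..<n}. e k y"])
      have yc: "y \<in> carrier M" "P y = y" using y by (auto simp: F_def)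
      have "P y = finsum M (\<lambda>k. (\<lambda>k\<in>{..<n}. e k y) k \<odot>\<^bsub>M\<^esub> x k) {..<n}"
        unfolding P_def using yc(1) e xc by (intro M.finsum_cong') auto
      then show "(\<lambda>k\<in>{..<n}. e k y) \<in> {..<n} \<rightarrow>\<^sub>E carrier R \<and>
          y = finsum M (\<lambda>k. (\<lambda>k\<in>{..<n}. e k y) k \<odot>\<^bsub>M\<^esub> x k) {..<n}"
        using yc e by auto
      fix c assume c: "c \<in> {..<n} \<rightarrow>\<^sub>E carrier R \<and> y = finsum M (\<lambda>k. c k \<odot>\<^bsub>M\<^esub> x k) {..<n}"
      then have "e j y = c j" if "j < n" for j
        using coord[of c j] that by (auto simp: PiE_def)
      then show "c = (\<lambda>k\<in>{..<n}. e k y)"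
        using c by (auto simp: PiE_def extensional_def restrict_def)
    qed
  qed
  moreover have "\<forall>k<n. e k \<in> E \<and> e k \<in> carrier M \<rightarrow> carrier R" using e by auto
  moreover have "\<forall>y\<in>carrier M. y \<ominus>\<^bsub>M\<^esub> finsum M (\<lambda>k. e k y \<odot>\<^bsub>M\<^esub> x k) {..<n} \<in> G"
    using PG unfolding P_def by blast
  ultimately have "free_E_summand R M E F n"
    unfolding free_E_summand_def using FM GM
    by (intro conjI exI[of _ G] exI[of _ x] exI[of _ e])
  moreover have "F \<subseteq> N"
  proof
    fix y assume y: "y \<in> F"
    then have "P y \<in> N"
      unfolding P_def using e x submoduleE(4)[OF N]
      by (intro submodule_finsum_closed[OF N]) (auto simp: F_def)
    then show "y \<in> N" using y by (simp add: F_def)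
  qed
  ultimately show ?thesis using that by blast
qed

text \<open>The values at \<open>x k\<close> of forms in \<open>E\<close> that vanish at the other
  vectors make up an ideal. By \<open>dual_at_exact\<close> no maximal ideal contains it, so 1 is
  such a value; this patches the local dual forms together.\<close>

lemma dual_basis_of_maximal:
  fixes n :: nat
  assumes noeth: "noetherian_ring R"
    and B: "\<And>m. maximalideal m R \<Longrightarrow> indep_at m {..<n} x" and x: "\<And>k. k < n \<Longrightarrow> x k \<in> carrier M"
    and k: "k < n"
  obtains f where "f \<in> E" "\<And>j. j < n \<Longrightarrow> f (x j) = (if j = k then \<one> else \<zero>)"
proof -
  define I where "I = {f (x k) | f. f \<in> E \<and> (\<forall>j<n. j \<noteq> k \<longrightarrow> f (x j) = \<zero>)}"
  have cmb: "a \<otimes> f (x k) \<ominus> b \<otimes> g (x k) \<in> I"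
    if "a \<in> carrier R" "b \<in> carrier R" "f \<in> E" "g \<in> E"
      "\<forall>j<n. j \<noteq> k \<longrightarrow> f (x j) = \<zero>" "\<forall>j<n. j \<noteq> k \<longrightarrow> g (x j) = \<zero>" for a b f g
    unfolding I_def using that x k
    by (intro CollectI exI[of _ "comb a f b g"]) (simp add: comb_in a_minus_def)
  have z: "(\<lambda>y\<in>carrier M. \<zero>) \<in> E" using E unfolding hom_submodule_def by blast
  have zx: "(\<lambda>y\<in>carrier M. \<zero>) (x j) = \<zero>" if "j < n" for j using x[OF that] by simp
  have zI: "\<zero> \<in> I"
    unfolding I_def using z zx k by (intro CollectI exI[of _ "\<lambda>y\<in>carrier M. \<zero>"]) simp
  have sub: "I \<subseteq> carrier R" using x k unfolding I_def by auto
  have mI: "r \<otimes> a \<in> I" if a: "a \<in> I" and r: "r \<in> carrier R" for a r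
  proof -
    obtain f where f: "a = f (x k)" "f \<in> E" "\<forall>j<n. j \<noteq> k \<longrightarrow> f (x j) = \<zero>"
      using a unfolding I_def by blast
    have "r \<otimes> f (x k) \<ominus> \<zero> \<otimes> f (x k) \<in> I" using cmb[of r \<zero> f f] f r by blast
    then show ?thesis using f r x k by (simp add: a_minus_def)
  qed
  have aI: "a \<oplus> b \<in> I" if a: "a \<in> I" and b: "b \<in> I" for a b
  proof -
    obtain f where f: "a = f (x k)" "f \<in> E" "\<forall>j<n. j \<noteq> k \<longrightarrow> f (x j) = \<zero>"
      using a unfolding I_def by blast
    obtain g where g: "b = g (x k)" "g \<in> E" "\<forall>j<n. j \<noteq> k \<longrightarrow> g (x j) = \<zero>"
      using b unfolding I_def by blast
    have "\<one> \<otimes> f (x k) \<ominus> (\<ominus> \<one>) \<otimes> g (x k) \<in> I" using cmb[of \<one> "\<ominus> \<one>" f g] f g by simp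
    then show ?thesis using f g x k by (simp add: a_minus_def l_minus)
  qed
  have "ideal I R"
  proof (rule idealI)
    show "ring R" by (rule R.ring_axioms)
    show "subgroup I (add_monoid R)"
    proof (rule R.add.subgroupI)
      show "\<ominus> a \<in> I" if "a \<in> I" for a
        using mI[OF that, of "\<ominus> \<one>"] that sub by (auto simp: l_minus)
    qed (use sub zI aI in auto)
    fix a r assume a: "a \<in> I" and r: "r \<in> carrier R"
    show "r \<otimes> a \<in> I" using mI[OF a r] .
    then show "a \<otimes> r \<in> I" using a r sub m_comm[of a r] by auto
  qed
  moreover have "\<not> I \<subseteq> m" if m: "maximalideal m R" for m
  proof -
    have p: "primeideal m R" using R.maximalideal_prime[OF m] .
    obtain u where u: "dual_at m {..<n} x u" using B[OF m] unfolding indep_at_def by blast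
    obtain v where v: "dual_at m {..<n} x v"
      "\<forall>j\<in>{..<n}. \<forall>k\<in>{..<n}. j \<noteq> k \<longrightarrow> v k (x j) = \<zero>"
      using dual_at_exact[OF p finite_lessThan u] by blast
    have "v k (x k) \<in> I" unfolding I_def using dual_atD(1)[OF v(1), of k] v(2) k by auto
    moreover have "v k (x k) \<notin> m" using dual_atD(3)[OF v(1), of k] k by simp
    ultimately show ?thesis by blast
  qed
  ultimately have "I = carrier R" using noetherian_ring.maximalideal_above[OF noeth] by metis
  then have "\<one> \<in> I" by simp
  then obtain f where "f \<in> E" "\<forall>j<n. j \<noteq> k \<longrightarrow> f (x j) = \<zero>" "f (x k) = \<one>"
    unfolding I_def by auto
  then show ?thesis using that[of f] k by simp
qed

section \<open>Reduction to \<open>i\<close> vectors\<close>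

lemma basic_family_iterate:
  assumes noeth: "noetherian_ring R" and N: "submodule N R M"
    and x: "\<And>k. k < i + d \<Longrightarrow> x k \<in> N" and B: "\<And>p. p \<in> j_spec R \<Longrightarrow> basic_family i (i + d) x p"
  obtains y where "\<And>k. k < i \<Longrightarrow> y k \<in> N" "\<And>p. p \<in> j_spec R \<Longrightarrow> basic_family i i y p"
proof -
  have "\<exists>y. (\<forall>k<i. y k \<in> N) \<and> (\<forall>p\<in>j_spec R. basic_family i i y p)"
    using x B
  proof (induction d arbitrary: x)
    case 0
    then show ?case by (intro exI[of _ x]) auto
  next
    case (Suc d)
    have "\<And>k. k \<le> i + d \<Longrightarrow> x k \<in> N" using Suc.prems(1) by simp
    moreover have "\<And>p. p \<in> j_spec R \<Longrightarrow> basic_family i (Suc (i + d)) x p"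
      using Suc.prems(2) by simp
    ultimately obtain y where "\<And>k. k \<le> i + d \<Longrightarrow> y k \<in> N"
      "\<And>p. p \<in> j_spec R \<Longrightarrow> basic_family i (i + d) y p"
      using basic_family_reduce[OF noeth N, of i "i + d" x] by blast
    then show ?case by (intro Suc.IH[of y]) simp_all
  qed
  then show ?thesis using that by blast
qed

theorem free_summand_of_local_rank:
  assumes noeth: "noetherian_ring R" and N: "submodule N R M" and fg: "fin_gen R (M\<lparr>carrier := N\<rparr>)"
    and loc: "\<And>p. p \<in> j_spec R \<Longrightarrow> \<exists>n b. indep_at p {..<n::nat} b \<and> b ` {..<n} \<subseteq> N \<and>
      enat i + dim_in (j_spec R) p \<le> enat n"
  obtains F where "free_E_summand R M E F i" "F \<subseteq> N"
proof -
  have NM: "N \<subseteq> carrier M" using submoduleE(1)[OF N] .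
  have "\<exists>A. finite A \<and> A \<subseteq> N \<and>
      (\<forall>y\<in>N. \<exists>c\<in>A \<rightarrow> carrier R. y = finsum (M\<lparr>carrier := N\<rparr>) (\<lambda>a. c a \<odot>\<^bsub>M\<^esub> a) A)"
    using fg by (simp add: fin_gen_def)
  then obtain A where A: "finite A" "A \<subseteq> N"
    and gen: "\<And>y. y \<in> N \<Longrightarrow> \<exists>c\<in>A \<rightarrow> carrier R. y = finsum (M\<lparr>carrier := N\<rparr>) (\<lambda>a. c a \<odot>\<^bsub>M\<^esub> a) A"
    by blast
  obtain g where g: "bij_betw g {..<card A} A"
    using ex_bij_betw_nat_finite[OF A(1)] unfolding atLeast0LessThan by blast
  \<comment> \<open>Zero vectors pad the generators, so that the length has the form
    \<open>i + d\<close> even with fewer than \<open>i\<close> generators.\<close>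
  define h where "h k = (if k < card A then g k else \<zero>\<^bsub>M\<^esub>)" for k
  have hA: "\<exists>k. k \<in> {..<i + card A} \<and> h k = a" if "a \<in> A" for a
  proof -
    have "a \<in> g ` {..<card A}" using g that by (simp add: bij_betw_def)
    then obtain k where "k < card A" "g k = a" by blast
    then show ?thesis by (intro exI[of _ k]) (simp add: h_def)
  qed
  have "\<zero>\<^bsub>M\<^esub> \<in> N" using subgroup.one_closed[OF submodule.axioms(1)[OF N]] by simp
  moreover have "g k \<in> A" if "k < card A" for k using g that by (auto simp: bij_betw_def)
  ultimately have hN: "h k \<in> N" for k using A(2) by (auto simp: h_def)
  have "basic_family i (i + card A) h p" if p: "p \<in> j_spec R" for p
  proof -
    have pp: "primeideal p R" using p by (simp add: j_spec_def)
    obtain n :: nat and b where b: "indep_at p {..<n} b" "b ` {..<n} \<subseteq> N"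
      "enat i + dim_in (j_spec R) p \<le> enat n" using loc[OF p] by blast
    obtain y where y: "indep_at p {..<n} y" "y ` {..<n} \<subseteq> A"
      using indep_at_generators[OF pp N A gen b(1) finite_lessThan b(2)] by blast
    have "\<forall>k\<in>{..<n}. \<exists>j. j \<in> {..<i + card A} \<and> h j = y k" using hA y(2) by blast
    then obtain r where "\<And>k. k \<in> {..<n} \<Longrightarrow> r k \<in> {..<i + card A} \<and> h (r k) = y k" by metis
    from indep_at_reindex[OF y(1), of r, OF this] show ?thesis
      using b(3) unfolding basic_family_def rank_ge_def by auto
  qed
  then obtain x where x: "\<And>k. k < i \<Longrightarrow> x k \<in> N"
    and B: "\<And>p. p \<in> j_spec R \<Longrightarrow> basic_family i i x p"
    using basic_family_iterate[OF noeth N, of i "card A" h] hN by blast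
  have xc: "\<And>k. k < i \<Longrightarrow> x k \<in> carrier M" using x NM by blast
  have ind: "indep_at m {..<i} x" if m: "maximalideal m R" for m
  proof -
    obtain n where n: "rank_ge m i x n" "n = i \<or> enat i + dim_in (j_spec R) m \<le> enat n"
      using B[OF R.maximalideal_in_j_spec[OF m]] unfolding basic_family_def by blast
    \<comment> \<open>With only \<open>i\<close> vectors left, both alternatives mean full rank: the
      dimension is nonnegative and the rank is at most \<open>i\<close>.\<close>
    have "n = i"
    proof (rule disjE[OF n(2)])
      assume "enat i + dim_in (j_spec R) m \<le> enat n"
      then have "enat i \<le> enat n" by (rule order_trans[rotated]) simp
      then show ?thesis using rank_ge_le[OF n(1)] by simp
    qed
    then obtain J where "J \<subseteq> {..<i}" "card J = i" "indep_at m J x"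
      using n(1) unfolding rank_ge_def by blast
    then show ?thesis by (metis card_lessThan card_subset_eq finite_lessThan)
  qed
  have "\<exists>f. f \<in> E \<and> (\<forall>j<i. f (x j) = (if j = k then \<one> else \<zero>))" if k: "k < i" for k
    by (rule dual_basis_of_maximal[OF noeth ind xc k]) blast+
  then have "\<exists>e. \<forall>k<i. e k \<in> E \<and> (\<forall>j<i. e k (x j) = (if j = k then \<one> else \<zero>))"
    by metis
  then obtain e where e: "\<And>k. k < i \<Longrightarrow> e k \<in> E"
    "\<And>j k. j < i \<Longrightarrow> k < i \<Longrightarrow> e k (x j) = (if j = k then \<one> else \<zero>)" by blast
  show ?thesis by (rule free_E_summand_dual_basis[OF N x e that])
qed

end

section \<open>Localisation at a prime\<close>

lemma (in abelian_group) minus_eq_zero_iff: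
  assumes "x \<in> carrier G" "y \<in> carrier G"
  shows "x \<ominus> y = \<zero> \<longleftrightarrow> x = y"
proof
  assume z: "x \<ominus> y = \<zero>"
  have "x = (x \<ominus> y) \<oplus> y" using assms by (simp add: minus_eq a_assoc l_neg)
  then show "x = y" using z assms by simp
qed (use assms in \<open>simp add: minus_eq r_neg\<close>)

locale module_at_prime = module R M + P: primeideal p R
  for R :: "('a,'r) ring_scheme" (structure) and M :: "('a,'m) module" (structure) and p :: "'a set"
begin

abbreviation (input) "S \<equiv> carrier R - p"
abbreviation (input) "D \<equiv> carrier M \<times> S"

declare P.one_notin [simp] P.mult_notin [simp]

lemma S_mult [simp]: "s \<in> S \<Longrightarrow> t \<in> S \<Longrightarrow> s \<otimes> t \<in> S"
  using P.mult_notin by auto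

lemma S_one [simp]: "\<one> \<in> S"
  using P.one_notin by simp

lemma S_carrier: "s \<in> S \<Longrightarrow> s \<in> carrier R"
  by simp

text \<open>Cross-multiplied equations without subtraction can be scaled by
  \<open>smult_scale\<close> and then chained.\<close>

lemma loc_rel_mod_iff:
  "((m, s), (m', s')) \<in> loc_rel_mod R M p \<longleftrightarrow> m \<in> carrier M \<and> m' \<in> carrier M \<and> s \<in> S \<and> s' \<in> S \<and>
     (\<exists>t\<in>S. (t \<otimes> s') \<odot>\<^bsub>M\<^esub> m = (t \<otimes> s) \<odot>\<^bsub>M\<^esub> m')"
proof -
  have "t \<odot>\<^bsub>M\<^esub> (s' \<odot>\<^bsub>M\<^esub> m \<ominus>\<^bsub>M\<^esub> s \<odot>\<^bsub>M\<^esub> m') = \<zero>\<^bsub>M\<^esub> \<longleftrightarrow> (t \<otimes> s') \<odot>\<^bsub>M\<^esub> m = (t \<otimes> s) \<odot>\<^bsub>M\<^esub> m'"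
    if "m \<in> carrier M" "m' \<in> carrier M" "s \<in> carrier R" "s' \<in> carrier R" "t \<in> carrier R" for t
  proof -
    have "t \<odot>\<^bsub>M\<^esub> (s' \<odot>\<^bsub>M\<^esub> m \<ominus>\<^bsub>M\<^esub> s \<odot>\<^bsub>M\<^esub> m') =
        (t \<otimes> s') \<odot>\<^bsub>M\<^esub> m \<ominus>\<^bsub>M\<^esub> (t \<otimes> s) \<odot>\<^bsub>M\<^esub> m'"
      using that by (simp add: M.minus_eq smult_r_distr smult_r_minus smult_assoc1)
    then show ?thesis
      using that by (simp add: M.minus_eq_zero_iff)
  qed
  then show ?thesis unfolding loc_rel_mod_def by auto
qed

lemma smult_scale:
  assumes "a \<odot>\<^bsub>M\<^esub> m = b \<odot>\<^bsub>M\<^esub> m'" "a \<in> carrier R" "b \<in> carrier R" "c \<in> carrier R"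
    "m \<in> carrier M" "m' \<in> carrier M"
  shows "(c \<otimes> a) \<odot>\<^bsub>M\<^esub> m = (c \<otimes> b) \<odot>\<^bsub>M\<^esub> m'"
  using assms by (simp add: smult_assoc1)

lemma equiv_loc_rel_mod: "equiv D (loc_rel_mod R M p)"
proof (rule equivI)
  show "loc_rel_mod R M p \<subseteq> D \<times> D" unfolding loc_rel_mod_def by auto
  show "refl_on D (loc_rel_mod R M p)"
    by (rule refl_onI) (auto simp: loc_rel_mod_iff intro: bexI[of _ \<one>])
  show "sym (loc_rel_mod R M p)"
    by (rule symI) (force simp: loc_rel_mod_iff)
  show "trans (loc_rel_mod R M p)"
  proof (rule transI)
    fix x y z assume xy: "(x, y) \<in> loc_rel_mod R M p" and yz: "(y, z) \<in> loc_rel_mod R M p"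
    obtain m s m' s' m'' s'' where e: "x = (m, s)" "y = (m', s')" "z = (m'', s'')"
      by (cases x, cases y, cases z) blast
    obtain t where t: "t \<in> S" "(t \<otimes> s') \<odot>\<^bsub>M\<^esub> m = (t \<otimes> s) \<odot>\<^bsub>M\<^esub> m'"
      using xy unfolding e loc_rel_mod_iff by blast
    obtain u where u: "u \<in> S" "(u \<otimes> s'') \<odot>\<^bsub>M\<^esub> m' = (u \<otimes> s') \<odot>\<^bsub>M\<^esub> m''"
      using yz unfolding e loc_rel_mod_iff by blast
    have S: "s \<in> S" "s' \<in> S" "s'' \<in> S" and m: "m \<in> carrier M" "m' \<in> carrier M" "m'' \<in> carrier M"
      using xy yz unfolding e loc_rel_mod_iff by blast+
    note C = S[THEN S_carrier] t(1)[THEN S_carrier] u(1)[THEN S_carrier]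
    \<comment> \<open>The common witness is \<open>t \<otimes> u \<otimes> s'\<close>: its factor
      \<open>s'\<close> lets both equations be scaled to the same coefficient of
      \<open>m'\<close>.\<close>
    have "((t \<otimes> u \<otimes> s') \<otimes> s'') \<odot>\<^bsub>M\<^esub> m = ((u \<otimes> s'') \<otimes> (t \<otimes> s')) \<odot>\<^bsub>M\<^esub> m"
      using C by (simp add: R.m_ac)
    also have "\<dots> = ((u \<otimes> s'') \<otimes> (t \<otimes> s)) \<odot>\<^bsub>M\<^esub> m'"
      using C m by (intro smult_scale[OF t(2)]) auto
    also have "\<dots> = ((t \<otimes> s) \<otimes> (u \<otimes> s'')) \<odot>\<^bsub>M\<^esub> m'"
      using C by (simp add: R.m_ac)
    also have "\<dots> = ((t \<otimes> s) \<otimes> (u \<otimes> s')) \<odot>\<^bsub>M\<^esub> m''"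
      using C m by (intro smult_scale[OF u(2)]) auto
    also have "\<dots> = ((t \<otimes> u \<otimes> s') \<otimes> s) \<odot>\<^bsub>M\<^esub> m''"
      using C by (simp add: R.m_ac)
    finally show "(x, z) \<in> loc_rel_mod R M p"
      unfolding e loc_rel_mod_iff using S m S_mult[OF S_mult[OF t(1) u(1)] S(2)] by blast
  qed
qed

definition frac :: "'m \<Rightarrow> 'a \<Rightarrow> ('m \<times> 'a) set" where
  "frac m s = loc_rel_mod R M p `` {(m, s)}"

lemma frac_eq_iff:
  assumes "m \<in> carrier M" "m' \<in> carrier M" "s \<in> S" "s' \<in> S"
  shows "frac m s = frac m' s' \<longleftrightarrow> (\<exists>t\<in>S. (t \<otimes> s') \<odot>\<^bsub>M\<^esub> m = (t \<otimes> s) \<odot>\<^bsub>M\<^esub> m')"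
  unfolding frac_def using eq_equiv_class_iff[OF equiv_loc_rel_mod, of "(m, s)" "(m', s')"] assms
  by (simp add: loc_rel_mod_iff)

lemma mem_frac: "(m', s') \<in> frac m s \<longleftrightarrow> m \<in> carrier M \<and> m' \<in> carrier M \<and> s \<in> S \<and> s' \<in> S \<and>
    (\<exists>t\<in>S. (t \<otimes> s') \<odot>\<^bsub>M\<^esub> m = (t \<otimes> s) \<odot>\<^bsub>M\<^esub> m')"
  unfolding frac_def by (simp add: loc_rel_mod_iff)

lemma frac_self: "m \<in> carrier M \<Longrightarrow> s \<in> S \<Longrightarrow> (m, s) \<in> frac m s"
  unfolding mem_frac by (auto intro: bexI[of _ \<one>])

lemma carrier_loc_module: "carrier (loc_module R M p) = {frac m s | m s. m \<in> carrier M \<and> s \<in> S}"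
  unfolding loc_module_def Let_def quotient_def frac_def by auto

lemma zero_loc_module: "\<zero>\<^bsub>loc_module R M p\<^esub> = frac \<zero>\<^bsub>M\<^esub> \<one>"
  unfolding loc_module_def Let_def frac_def by simp

lemma frac_zero:
  assumes "s \<in> S"
  shows "frac \<zero>\<^bsub>M\<^esub> s = frac \<zero>\<^bsub>M\<^esub> \<one>"
proof -
  have "\<exists>t\<in>S. (t \<otimes> \<one>) \<odot>\<^bsub>M\<^esub> \<zero>\<^bsub>M\<^esub> = (t \<otimes> s) \<odot>\<^bsub>M\<^esub> \<zero>\<^bsub>M\<^esub>"
    using assms by (intro bexI[of _ \<one>]) simp_all
  then show ?thesis
    by (rule iffD2[OF frac_eq_iff[OF M.zero_closed M.zero_closed assms S_one]])
qed

text \<open>Addition in \<open>loc_module\<close> is a union over all choices of representatives. By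
  \<open>wd\<close> they give one and the same class, so the union is that class. The product of the
  two given witnesses is the new one.\<close>

lemma frac_add:
  assumes m: "m \<in> carrier M" "m' \<in> carrier M" and s: "s \<in> S" "s' \<in> S"
  shows "frac m s \<oplus>\<^bsub>loc_module R M p\<^esub> frac m' s' =
    frac (s' \<odot>\<^bsub>M\<^esub> m \<oplus>\<^bsub>M\<^esub> s \<odot>\<^bsub>M\<^esub> m') (s \<otimes> s')"
proof -
  have wd: "frac (b' \<odot>\<^bsub>M\<^esub> a \<oplus>\<^bsub>M\<^esub> b \<odot>\<^bsub>M\<^esub> a') (b \<otimes> b') =
      frac (s' \<odot>\<^bsub>M\<^esub> m \<oplus>\<^bsub>M\<^esub> s \<odot>\<^bsub>M\<^esub> m') (s \<otimes> s')"
    if rep: "(a, b) \<in> frac m s" "(a', b') \<in> frac m' s'" for a b a' b'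
  proof -
    obtain t where t: "t \<in> S" "(t \<otimes> b) \<odot>\<^bsub>M\<^esub> m = (t \<otimes> s) \<odot>\<^bsub>M\<^esub> a"
      using rep(1) unfolding mem_frac by blast
    obtain u where u: "u \<in> S" "(u \<otimes> b') \<odot>\<^bsub>M\<^esub> m' = (u \<otimes> s') \<odot>\<^bsub>M\<^esub> a'"
      using rep(2) unfolding mem_frac by blast
    have ab: "a \<in> carrier M" "a' \<in> carrier M" "b \<in> S" "b' \<in> S"
      using rep unfolding mem_frac by blast+
    note C = s[THEN S_carrier] ab(3,4)[THEN S_carrier] t(1)[THEN S_carrier] u(1)[THEN S_carrier]
    have "((t \<otimes> u) \<otimes> (s \<otimes> s')) \<odot>\<^bsub>M\<^esub> (b' \<odot>\<^bsub>M\<^esub> a \<oplus>\<^bsub>M\<^esub> b \<odot>\<^bsub>M\<^esub> a') =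
        ((u \<otimes> s' \<otimes> b') \<otimes> (t \<otimes> s)) \<odot>\<^bsub>M\<^esub> a \<oplus>\<^bsub>M\<^esub> ((t \<otimes> s \<otimes> b) \<otimes> (u \<otimes> s')) \<odot>\<^bsub>M\<^esub> a'"
      using C ab(1,2) by (simp add: smult_r_distr smult_assoc1[symmetric] R.m_ac)
    also have "((u \<otimes> s' \<otimes> b') \<otimes> (t \<otimes> s)) \<odot>\<^bsub>M\<^esub> a = ((u \<otimes> s' \<otimes> b') \<otimes> (t \<otimes> b)) \<odot>\<^bsub>M\<^esub> m"
      using C ab(1) m by (intro smult_scale[OF t(2), symmetric]) auto
    also have "((t \<otimes> s \<otimes> b) \<otimes> (u \<otimes> s')) \<odot>\<^bsub>M\<^esub> a' = ((t \<otimes> s \<otimes> b) \<otimes> (u \<otimes> b')) \<odot>\<^bsub>M\<^esub> m'"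
      using C ab(2) m by (intro smult_scale[OF u(2), symmetric]) auto
    also have "((u \<otimes> s' \<otimes> b') \<otimes> (t \<otimes> b)) \<odot>\<^bsub>M\<^esub> m \<oplus>\<^bsub>M\<^esub> ((t \<otimes> s \<otimes> b) \<otimes> (u \<otimes> b')) \<odot>\<^bsub>M\<^esub> m' =
        ((t \<otimes> u) \<otimes> (b \<otimes> b')) \<odot>\<^bsub>M\<^esub> (s' \<odot>\<^bsub>M\<^esub> m \<oplus>\<^bsub>M\<^esub> s \<odot>\<^bsub>M\<^esub> m')"
      using C m by (simp add: smult_r_distr smult_assoc1[symmetric] R.m_ac)
    finally have "\<exists>w\<in>S. (w \<otimes> (s \<otimes> s')) \<odot>\<^bsub>M\<^esub> (b' \<odot>\<^bsub>M\<^esub> a \<oplus>\<^bsub>M\<^esub> b \<odot>\<^bsub>M\<^esub> a') =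
        (w \<otimes> (b \<otimes> b')) \<odot>\<^bsub>M\<^esub> (s' \<odot>\<^bsub>M\<^esub> m \<oplus>\<^bsub>M\<^esub> s \<odot>\<^bsub>M\<^esub> m')"
      using S_mult[OF t(1) u(1)] by (rule bexI)
    then show ?thesis
      using C ab m s S_mult[OF ab(3,4)] S_mult[OF s] by (subst frac_eq_iff) simp_all
  qed
  have "frac m s \<oplus>\<^bsub>loc_module R M p\<^esub> frac m' s' =
    \<Union>{frac (b' \<odot>\<^bsub>M\<^esub> a \<oplus>\<^bsub>M\<^esub> b \<odot>\<^bsub>M\<^esub> a') (b \<otimes> b') | a b a' b'. (a, b) \<in> frac m s \<and> (a', b') \<in> frac m' s'}"
    unfolding loc_module_def Let_def frac_def by simp
  also have "{frac (b' \<odot>\<^bsub>M\<^esub> a \<oplus>\<^bsub>M\<^esub> b \<odot>\<^bsub>M\<^esub> a') (b \<otimes> b') | a b a' b'. (a, b) \<in> frac m s \<and> (a', b') \<in> frac m' s'} =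
      {frac (s' \<odot>\<^bsub>M\<^esub> m \<oplus>\<^bsub>M\<^esub> s \<odot>\<^bsub>M\<^esub> m') (s \<otimes> s')}" (is "?A = {?c}")
  proof
    show "?A \<subseteq> {?c}" using wd by blast
    show "{?c} \<subseteq> ?A" using frac_self[OF m(1) s(1)] frac_self[OF m(2) s(2)] by blast
  qed
  finally show ?thesis by simp
qed

text \<open>Makes \<open>finsum\<close> and differences in M_p available to
  \<open>loc_coordinates\<close>, where scalars enter through closure of \<open>F\<close> and the
  action of 0 and 1.\<close>

lemma abelian_group_loc_module: "abelian_group (loc_module R M p)"
proof (rule abelian_groupI)
  let ?L = "loc_module R M p"
  fix x y z assume "x \<in> carrier ?L" "y \<in> carrier ?L" "z \<in> carrier ?L"
  then obtain m s m' s' m'' s'' where e: "x = frac m s" "y = frac m' s'" "z = frac m'' s''"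
    and m: "m \<in> carrier M" "m' \<in> carrier M" "m'' \<in> carrier M" and s: "s \<in> S" "s' \<in> S" "s'' \<in> S"
    unfolding carrier_loc_module by blast
  note C = s[THEN S_carrier]
  have sm: "s \<otimes> s' \<in> S" "s' \<otimes> s'' \<in> S" using s by simp_all
  have mm: "s' \<odot>\<^bsub>M\<^esub> m \<oplus>\<^bsub>M\<^esub> s \<odot>\<^bsub>M\<^esub> m' \<in> carrier M" "s'' \<odot>\<^bsub>M\<^esub> m' \<oplus>\<^bsub>M\<^esub> s' \<odot>\<^bsub>M\<^esub> m'' \<in> carrier M"
    using C m by auto
  have "s'' \<odot>\<^bsub>M\<^esub> (s' \<odot>\<^bsub>M\<^esub> m \<oplus>\<^bsub>M\<^esub> s \<odot>\<^bsub>M\<^esub> m') \<oplus>\<^bsub>M\<^esub> (s \<otimes> s') \<odot>\<^bsub>M\<^esub> m'' =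
      (s' \<otimes> s'') \<odot>\<^bsub>M\<^esub> m \<oplus>\<^bsub>M\<^esub> s \<odot>\<^bsub>M\<^esub> (s'' \<odot>\<^bsub>M\<^esub> m' \<oplus>\<^bsub>M\<^esub> s' \<odot>\<^bsub>M\<^esub> m'')"
    using C m by (simp add: smult_r_distr smult_assoc1[symmetric] R.m_ac M.a_assoc)
  moreover have "(s \<otimes> s') \<otimes> s'' = s \<otimes> (s' \<otimes> s'')" using C by (simp add: R.m_assoc)
  ultimately show "x \<oplus>\<^bsub>?L\<^esub> y \<oplus>\<^bsub>?L\<^esub> z = x \<oplus>\<^bsub>?L\<^esub> (y \<oplus>\<^bsub>?L\<^esub> z)"
    unfolding e frac_add[OF m(1,2) s(1,2)] frac_add[OF m(2,3) s(2,3)]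
      frac_add[OF mm(1) m(3) sm(1) s(3)] frac_add[OF m(1) mm(2) s(1) sm(2)] by simp
next
  let ?L = "loc_module R M p"
  fix x y assume "x \<in> carrier ?L" "y \<in> carrier ?L"
  then obtain m s m' s' where e: "x = frac m s" "y = frac m' s'"
    and m: "m \<in> carrier M" "m' \<in> carrier M" and s: "s \<in> S" "s' \<in> S"
    unfolding carrier_loc_module by blast
  note C = s[THEN S_carrier]
  have "s' \<odot>\<^bsub>M\<^esub> m \<oplus>\<^bsub>M\<^esub> s \<odot>\<^bsub>M\<^esub> m' \<in> carrier M" using C m by auto
  then show "x \<oplus>\<^bsub>?L\<^esub> y \<in> carrier ?L"
    unfolding e frac_add[OF m s] carrier_loc_module using S_mult[OF s] by blast
  show "x \<oplus>\<^bsub>?L\<^esub> y = y \<oplus>\<^bsub>?L\<^esub> x"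
    unfolding e frac_add[OF m s] frac_add[OF m(2,1) s(2,1)]
    using C m by (simp add: M.a_comm R.m_comm)
next
  let ?L = "loc_module R M p"
  show "\<zero>\<^bsub>?L\<^esub> \<in> carrier ?L"
    unfolding zero_loc_module carrier_loc_module using S_one M.zero_closed by blast
  fix x assume x: "x \<in> carrier ?L"
  then obtain m s where e: "x = frac m s" and m: "m \<in> carrier M" and s: "s \<in> S"
    unfolding carrier_loc_module by blast
  note C = s[THEN S_carrier]
  show "\<zero>\<^bsub>?L\<^esub> \<oplus>\<^bsub>?L\<^esub> x = x"
    unfolding e zero_loc_module frac_add[OF M.zero_closed m S_one s] using C m by simp
  have "frac (\<ominus>\<^bsub>M\<^esub> m) s \<oplus>\<^bsub>?L\<^esub> x = frac (s \<odot>\<^bsub>M\<^esub> (\<ominus>\<^bsub>M\<^esub> m) \<oplus>\<^bsub>M\<^esub> s \<odot>\<^bsub>M\<^esub> m) (s \<otimes> s)"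
    unfolding e using m s by (intro frac_add) auto
  also have "s \<odot>\<^bsub>M\<^esub> (\<ominus>\<^bsub>M\<^esub> m) \<oplus>\<^bsub>M\<^esub> s \<odot>\<^bsub>M\<^esub> m = \<zero>\<^bsub>M\<^esub>"
    using C m by (simp add: smult_r_minus M.l_neg)
  also have "frac \<zero>\<^bsub>M\<^esub> (s \<otimes> s) = \<zero>\<^bsub>?L\<^esub>"
    unfolding zero_loc_module using frac_zero[OF S_mult[OF s s]] .
  finally show "\<exists>y\<in>carrier ?L. y \<oplus>\<^bsub>?L\<^esub> x = \<zero>\<^bsub>?L\<^esub>"
    unfolding carrier_loc_module using m s M.a_inv_closed by blast
qed

end

text \<open>\<open>R\<close> as a module over itself, so that facts about fractions in M_p
  specialise to R_p.\<close>

definition regular_module :: "('a,'r) ring_scheme \<Rightarrow> ('a,'a) module" where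
  "regular_module R = \<lparr>carrier = carrier R, monoid.mult = monoid.mult R, monoid.one = monoid.one R,
     ring.zero = ring.zero R, ring.add = ring.add R, module.smult = monoid.mult R\<rparr>"

lemma regular_module_sel [simp]:
  "carrier (regular_module R) = carrier R" "ring.zero (regular_module R) = ring.zero R"
  "ring.add (regular_module R) = ring.add R" "module.smult (regular_module R) = monoid.mult R"
  by (simp_all add: regular_module_def)

lemma regular_module_minus [simp]: "x \<ominus>\<^bsub>regular_module R\<^esub> y = x \<ominus>\<^bsub>R\<^esub> y"
  by (simp add: a_minus_def a_inv_def m_inv_def)

lemma (in cring) module_regular_module: "module R (regular_module R)"
proof (rule moduleI)
  show "abelian_group (regular_module R)"
  proof (rule abelian_groupI)
    fix x assume "x \<in> carrier (regular_module R)"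
    then show "\<exists>y\<in>carrier (regular_module R).
        y \<oplus>\<^bsub>regular_module R\<^esub> x = \<zero>\<^bsub>regular_module R\<^esub>"
      by (intro bexI[of _ "\<ominus> x"]) (simp_all add: l_neg)
  qed (simp_all add: a_ac)
qed (auto simp: cring_axioms l_distr r_distr m_assoc)

lemma loc_rel_regular_module: "loc_rel_mod R (regular_module R) p = loc_rel_ring R p"
  unfolding loc_rel_mod_def loc_rel_ring_def by simp

context module_at_prime
begin

lemma regular: "module_at_prime R (regular_module R) p"
  unfolding module_at_prime_def using R.module_regular_module P.primeideal_axioms by blast

definition rfrac :: "'a \<Rightarrow> 'a \<Rightarrow> ('a \<times> 'a) set" where
  "rfrac r s = loc_rel_ring R p `` {(r, s)}"

lemma rfrac_regular: "rfrac r s = module_at_prime.frac R (regular_module R) p r s"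
  unfolding rfrac_def module_at_prime.frac_def[OF regular] loc_rel_regular_module ..

lemma rfrac_eq_iff:
  assumes "r \<in> carrier R" "r' \<in> carrier R" "s \<in> S" "s' \<in> S"
  shows "rfrac r s = rfrac r' s' \<longleftrightarrow> (\<exists>t\<in>S. (t \<otimes> s') \<otimes> r = (t \<otimes> s) \<otimes> r')"
  using module_at_prime.frac_eq_iff[OF regular] assms unfolding rfrac_regular by simp

lemma mem_rfrac: "(r', s') \<in> rfrac r s \<longleftrightarrow> r \<in> carrier R \<and> r' \<in> carrier R \<and> s \<in> S \<and> s' \<in> S \<and>
    (\<exists>t\<in>S. (t \<otimes> s') \<otimes> r = (t \<otimes> s) \<otimes> r')"
  using module_at_prime.mem_frac[OF regular] unfolding rfrac_regular by simp

lemma rfrac_self: "r \<in> carrier R \<Longrightarrow> s \<in> S \<Longrightarrow> (r, s) \<in> rfrac r s"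
  using module_at_prime.frac_self[OF regular] unfolding rfrac_regular by simp

lemma carrier_loc_ring: "carrier (loc_ring R p) = {rfrac r s | r s. r \<in> carrier R \<and> s \<in> S}"
  unfolding loc_ring_def Let_def quotient_def rfrac_def by auto

lemma rfrac_smult:
  assumes r: "r \<in> carrier R" "s \<in> S" and m: "m \<in> carrier M" "t \<in> S"
  shows "rfrac r s \<odot>\<^bsub>loc_module R M p\<^esub> frac m t = frac (r \<odot>\<^bsub>M\<^esub> m) (s \<otimes> t)"
proof -
  have wd: "frac (r' \<odot>\<^bsub>M\<^esub> m') (s' \<otimes> t') = frac (r \<odot>\<^bsub>M\<^esub> m) (s \<otimes> t)"
    if rep: "(r', s') \<in> rfrac r s" "(m', t') \<in> frac m t" for r' s' m' t'
  proof -
    obtain x where x: "x \<in> S" "(x \<otimes> s') \<otimes> r = (x \<otimes> s) \<otimes> r'"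
      using rep(1) unfolding mem_rfrac by blast
    obtain y where y: "y \<in> S" "(y \<otimes> t') \<odot>\<^bsub>M\<^esub> m = (y \<otimes> t) \<odot>\<^bsub>M\<^esub> m'"
      using rep(2) unfolding mem_frac by blast
    have ab: "m' \<in> carrier M" "r' \<in> carrier R" "s' \<in> S" "t' \<in> S"
      using rep unfolding mem_frac mem_rfrac by blast+
    note C = r(1) ab(2) r(2)[THEN S_carrier] m(2)[THEN S_carrier] ab(3,4)[THEN S_carrier]
      x(1)[THEN S_carrier] y(1)[THEN S_carrier]
    have "((x \<otimes> y) \<otimes> (s \<otimes> t)) \<odot>\<^bsub>M\<^esub> (r' \<odot>\<^bsub>M\<^esub> m') = ((x \<otimes> s \<otimes> r') \<otimes> (y \<otimes> t)) \<odot>\<^bsub>M\<^esub> m'"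
      using C ab(1) by (simp add: smult_assoc1[symmetric] R.m_ac)
    also have "\<dots> = ((x \<otimes> s \<otimes> r') \<otimes> (y \<otimes> t')) \<odot>\<^bsub>M\<^esub> m"
      using C ab(1) m(1) by (intro smult_scale[OF y(2), symmetric]) auto
    also have "\<dots> = ((x \<otimes> s' \<otimes> r) \<otimes> (y \<otimes> t')) \<odot>\<^bsub>M\<^esub> m" unfolding x(2) ..
    also have "\<dots> = ((x \<otimes> y) \<otimes> (s' \<otimes> t')) \<odot>\<^bsub>M\<^esub> (r \<odot>\<^bsub>M\<^esub> m)"
      using C m(1) by (simp add: smult_assoc1[symmetric] R.m_ac)
    finally have "\<exists>w\<in>S. (w \<otimes> (s \<otimes> t)) \<odot>\<^bsub>M\<^esub> (r' \<odot>\<^bsub>M\<^esub> m') = (w \<otimes> (s' \<otimes> t')) \<odot>\<^bsub>M\<^esub> (r \<odot>\<^bsub>M\<^esub> m)"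
      using S_mult[OF x(1) y(1)] by (rule bexI)
    then show ?thesis
      using C ab(1) m(1) S_mult[OF ab(3,4)] S_mult[OF r(2) m(2)] by (subst frac_eq_iff) simp_all
  qed
  have "rfrac r s \<odot>\<^bsub>loc_module R M p\<^esub> frac m t =
    \<Union>{frac (r' \<odot>\<^bsub>M\<^esub> m') (s' \<otimes> t') | r' s' m' t'. (r', s') \<in> rfrac r s \<and> (m', t') \<in> frac m t}"
    unfolding loc_module_def Let_def frac_def by simp
  also have "{frac (r' \<odot>\<^bsub>M\<^esub> m') (s' \<otimes> t') | r' s' m' t'. (r', s') \<in> rfrac r s \<and> (m', t') \<in> frac m t} =
      {frac (r \<odot>\<^bsub>M\<^esub> m) (s \<otimes> t)}" (is "?A = {?c}")
  proof
    show "?A \<subseteq> {?c}" using wd by blast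
    show "{?c} \<subseteq> ?A" using rfrac_self[OF r] frac_self[OF m] by blast
  qed
  finally show ?thesis by simp
qed

end

section \<open>Localised forms and coordinates of a local summand\<close>

locale form_space_at_prime = form_space R M E + module_at_prime R M p
  for R :: "('a,'r) ring_scheme" (structure) and M :: "('a,'m) module" (structure)
    and E :: "('m \<Rightarrow> 'a) set" and p :: "'a set"
begin

definition loc_form :: "('m \<Rightarrow> 'a) \<Rightarrow> 'a \<Rightarrow> ('m \<times> 'a) set \<Rightarrow> ('a \<times> 'a) set" where
  "loc_form e s = (\<lambda>U\<in>carrier (loc_module R M p).
     \<Union>{loc_rel_ring R p `` {(e m, s \<otimes> t)} | m t. (m, t) \<in> U})"

lemma loc_formsE:
  assumes "f \<in> loc_forms R M E p"
  obtains e s where "e \<in> E" "s \<in> S" "f = loc_form e s"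
proof -
  obtain z where z: "z \<in> E \<times> S"
    "f = (\<lambda>(e, s). \<lambda>U\<in>carrier (loc_module R M p).
       \<Union>{loc_rel_ring R p `` {(e m, s \<otimes> t)} | m t. (m, t) \<in> U}) z"
    using assms unfolding loc_forms_def by (rule imageE)
  obtain e s where "z = (e, s)" by (cases z)
  then show thesis using z that[of e s] by (simp add: loc_form_def)
qed

lemma loc_form_frac:
  assumes e: "e \<in> E" and s: "s \<in> S" and m: "m \<in> carrier M" "t \<in> S"
  shows "loc_form e s (frac m t) = rfrac (e m) (s \<otimes> t)"
proof -
  have wd: "rfrac (e m') (s \<otimes> t') = rfrac (e m) (s \<otimes> t)" if rep: "(m', t') \<in> frac m t" for m' t'
  proof -
    obtain y where y: "y \<in> S" "(y \<otimes> t') \<odot>\<^bsub>M\<^esub> m = (y \<otimes> t) \<odot>\<^bsub>M\<^esub> m'"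
      using rep unfolding mem_frac by blast
    have ab: "m' \<in> carrier M" "t' \<in> S"
      using rep unfolding mem_frac by blast+
    note C = s[THEN S_carrier] m(2)[THEN S_carrier] ab(2)[THEN S_carrier] y(1)[THEN S_carrier]
    have ec: "e m \<in> carrier R" "e m' \<in> carrier R" using e m ab by auto
    have "(y \<otimes> t') \<otimes> e m = (y \<otimes> t) \<otimes> e m'"
      using arg_cong[OF y(2), of e] C e m(1) ab(1) by (simp add: form_smult)
    then have eq: "s \<otimes> ((y \<otimes> t') \<otimes> e m) = s \<otimes> ((y \<otimes> t) \<otimes> e m')" by simp
    have "(y \<otimes> (s \<otimes> t)) \<otimes> e m' = s \<otimes> ((y \<otimes> t) \<otimes> e m')"
      using C ec by (simp add: R.m_ac)
    also have "\<dots> = (y \<otimes> (s \<otimes> t')) \<otimes> e m"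
      unfolding eq[symmetric] using C ec by (simp add: R.m_ac)
    finally have "\<exists>w\<in>S. (w \<otimes> (s \<otimes> t)) \<otimes> e m' = (w \<otimes> (s \<otimes> t')) \<otimes> e m"
      using y(1) by (rule bexI)
    then show ?thesis
      by (rule iffD2[OF rfrac_eq_iff[OF ec(2,1) S_mult[OF s ab(2)] S_mult[OF s m(2)]]])
  qed
  have "frac m t \<in> carrier (loc_module R M p)" unfolding carrier_loc_module using m by blast
  then have "loc_form e s (frac m t) = \<Union>{rfrac (e m') (s \<otimes> t') | m' t'. (m', t') \<in> frac m t}"
    unfolding rfrac_def loc_form_def by simp
  also have "{rfrac (e m') (s \<otimes> t') | m' t'. (m', t') \<in> frac m t} = {rfrac (e m) (s \<otimes> t)}"
    (is "?A = {?c}")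
  proof
    show "?A \<subseteq> {?c}" using wd by blast
    show "{?c} \<subseteq> ?A" using frac_self[OF m] by blast
  qed
  finally show ?thesis by simp
qed

text \<open>The difference of \<open>b j\<close> and its projection lies in both \<open>F\<close>
  and \<open>G\<close>, hence is zero. So \<open>b j\<close> has two expansions in the basis, one
  with coefficients \<open>\<phi> k (b j)\<close> and one with Kronecker deltas, and uniqueness
  identifies them.\<close>

lemma loc_coordinates:
  assumes "free_E_summand (loc_ring R p) (loc_module R M p) EE F n"
  obtains b \<phi> where "b \<in> {..<n} \<rightarrow> F" "\<And>k. k < n \<Longrightarrow> \<phi> k \<in> EE"
    "\<And>j k. j < n \<Longrightarrow> k < n \<Longrightarrow> \<phi> k (b j) = (if j = k then rfrac \<one> \<one> else rfrac \<zero> \<one>)"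
proof -
  let ?L = "loc_module R M p" and ?A = "loc_ring R p"
  interpret L: abelian_group ?L by (rule abelian_group_loc_module)
  obtain G b \<phi> where F: "submodule F ?A ?L" and G: "submodule G ?A ?L" and FG: "F \<inter> G = {\<zero>\<^bsub>?L\<^esub>}"
    and b: "b \<in> {..<n} \<rightarrow> F"
    and uniq: "\<forall>x\<in>F. \<exists>!c. c \<in> {..<n} \<rightarrow>\<^sub>E carrier ?A \<and> x = finsum ?L (\<lambda>k. c k \<odot>\<^bsub>?L\<^esub> b k) {..<n}"
    and phi: "\<forall>k<n. \<phi> k \<in> EE \<and> \<phi> k \<in> carrier ?L \<rightarrow> carrier ?A"
    and proj: "\<forall>x\<in>carrier ?L. x \<ominus>\<^bsub>?L\<^esub> finsum ?L (\<lambda>k. \<phi> k x \<odot>\<^bsub>?L\<^esub> b k) {..<n} \<in> G"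
    using assms unfolding free_E_summand_def by (elim conjE exE) blast
  have phiA: "\<phi> k y \<in> carrier ?A" if "k < n" "y \<in> carrier ?L" for k y
    using phi that by blast
  have Fsub: "subgroup F (add_monoid ?L)" using F by (rule submodule.axioms)
  have FL: "F \<subseteq> carrier ?L" using subgroup.subset[OF Fsub] by simp
  have Fadd: "x \<oplus>\<^bsub>?L\<^esub> y \<in> F" if "x \<in> F" "y \<in> F" for x y
    using subgroup.m_closed[OF Fsub that] by simp
  have Fneg: "\<ominus>\<^bsub>?L\<^esub> x \<in> F" if "x \<in> F" for x
    using subgroup.m_inv_closed[OF Fsub that] by (simp add: a_inv_def)
  have Fzero: "\<zero>\<^bsub>?L\<^esub> \<in> F" using FG by blast
  have Fsum: "finsum ?L g T \<in> F" if "finite T" "g \<in> T \<rightarrow> F" for g and T :: "nat set"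
    using that
  proof (induction T rule: finite_induct)
    case (insert a T)
    have "g \<in> T \<rightarrow> carrier ?L" "g a \<in> carrier ?L" using insert(4) FL by auto
    from L.finsum_insert[OF insert(1,2) this] show ?case using insert Fadd by simp
  qed (simp add: Fzero)
  have zA: "rfrac \<zero> \<one> \<in> carrier ?A" and oA: "rfrac \<one> \<one> \<in> carrier ?A"
    unfolding carrier_loc_ring using S_one by blast+
  have sm: "rfrac \<one> \<one> \<odot>\<^bsub>?L\<^esub> x = x" "rfrac \<zero> \<one> \<odot>\<^bsub>?L\<^esub> x = \<zero>\<^bsub>?L\<^esub>" if x: "x \<in> carrier ?L" for x
  proof -
    obtain m s where e: "x = frac m s" and m: "m \<in> carrier M" and s: "s \<in> S"
      using x unfolding carrier_loc_module by blast
    note sc = s[THEN S_carrier]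
    show "rfrac \<one> \<one> \<odot>\<^bsub>?L\<^esub> x = x"
      unfolding e rfrac_smult[OF R.one_closed S_one m s] using m sc by simp
    show "rfrac \<zero> \<one> \<odot>\<^bsub>?L\<^esub> x = \<zero>\<^bsub>?L\<^esub>"
      unfolding e rfrac_smult[OF R.zero_closed S_one m s] zero_loc_module
      using m sc frac_zero[OF s] by simp
  qed
  have coord: "\<phi> k (b j) = (if j = k then rfrac \<one> \<one> else rfrac \<zero> \<one>)" if j: "j < n" and k: "k < n" for j k
  proof -
    have bF: "b l \<in> F" if "l < n" for l using b that by auto
    have bL: "b l \<in> carrier ?L" if "l < n" for l using bF[OF that] FL by blast
    \<comment> \<open>Uniqueness ranges over extensional coefficient families, so both are cut off
      outside \<open>{..<n}\<close>.\<close>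
    define c1 where "c1 = (\<lambda>k\<in>{..<n}. \<phi> k (b j))"
    define c2 where "c2 = (\<lambda>k\<in>{..<n}. if j = k then rfrac \<one> \<one> else rfrac \<zero> \<one>)"
    have c1: "c1 \<in> {..<n} \<rightarrow>\<^sub>E carrier ?A" unfolding c1_def using phiA[OF _ bL[OF j]] by auto
    have c2: "c2 \<in> {..<n} \<rightarrow>\<^sub>E carrier ?A" unfolding c2_def using zA oA by auto
    let ?s = "finsum ?L (\<lambda>k. \<phi> k (b j) \<odot>\<^bsub>?L\<^esub> b k) {..<n}"
    have sF: "(\<lambda>k. \<phi> k (b j) \<odot>\<^bsub>?L\<^esub> b k) \<in> {..<n} \<rightarrow> F"
      using submodule.smult_closed[OF F phiA[OF _ bL[OF j]] bF] by simp
    then have s: "?s \<in> F" by (intro Fsum) auto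
    have "b j \<ominus>\<^bsub>?L\<^esub> ?s \<in> F"
      unfolding L.minus_eq using Fadd Fneg s bF[OF j] by blast
    moreover have "b j \<ominus>\<^bsub>?L\<^esub> ?s \<in> G" using proj bL[OF j] by blast
    ultimately have "b j \<ominus>\<^bsub>?L\<^esub> ?s = \<zero>\<^bsub>?L\<^esub>" using FG by blast
    then have "b j = ?s" using L.minus_eq_zero_iff[OF bL[OF j]] s FL by blast
    also have "\<dots> = finsum ?L (\<lambda>k. c1 k \<odot>\<^bsub>?L\<^esub> b k) {..<n}"
      using sF FL by (intro L.finsum_cong') (auto simp: c1_def)
    finally have e1: "b j = finsum ?L (\<lambda>k. c1 k \<odot>\<^bsub>?L\<^esub> b k) {..<n}" .
    have "finsum ?L (\<lambda>k. c2 k \<odot>\<^bsub>?L\<^esub> b k) {..<n} = finsum ?L (\<lambda>k. if j = k then b k else \<zero>\<^bsub>?L\<^esub>) {..<n}"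
      using bL sm by (intro L.finsum_cong') (auto simp: c2_def)
    also have "\<dots> = b j" using j bL by (intro L.finsum_singleton) auto
    finally have e2: "b j = finsum ?L (\<lambda>k. c2 k \<odot>\<^bsub>?L\<^esub> b k) {..<n}" by (rule sym)
    have "\<exists>!c. c \<in> {..<n} \<rightarrow>\<^sub>E carrier ?A \<and> b j = finsum ?L (\<lambda>k. c k \<odot>\<^bsub>?L\<^esub> b k) {..<n}"
      using uniq bF[OF j] by (rule bspec)
    then have "\<exists>\<^sub>\<le>\<^sub>1c. c \<in> {..<n} \<rightarrow>\<^sub>E carrier ?A \<and> b j = finsum ?L (\<lambda>k. c k \<odot>\<^bsub>?L\<^esub> b k) {..<n}"
      unfolding ex1_iff_ex_Uniq by (rule conjunct2)
    then have "c1 = c2" by (rule Uniq_D) (rule conjI[OF c1 e1], rule conjI[OF c2 e2])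
    then have "c1 k = c2 k" by simp
    then show ?thesis unfolding c1_def c2_def using k by simp
  qed
  show thesis
  proof (rule that[OF b])
    show "\<phi> k \<in> EE" if "k < n" for k using phi that by blast
  qed (rule coord)
qed

text \<open>Numerators suffice: write \<open>b j\<close> as \<open>x j\<close> over
  \<open>t j\<close> and \<open>\<phi> k\<close> as \<open>e k\<close> over \<open>s k\<close>. A
  fraction equal to 1 in R_p has its numerator outside \<open>p\<close>; one equal to 0 has a
  numerator killed by an element outside \<open>p\<close>, hence in \<open>p\<close>. The inclusion
  of \<open>F\<close> allows \<open>x j\<close> to be chosen in \<open>N\<close>.\<close>

lemma indep_at_of_loc_summand:
  assumes free: "free_E_summand (loc_ring R p) (loc_module R M p) (loc_forms R M E p) F n"
    and F: "F \<subseteq> loc_sub R M N p" and N: "N \<subseteq> carrier M"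
  obtains x where "indep_at p {..<n} x" "x ` {..<n} \<subseteq> N"
proof -
  obtain b \<phi> where b: "b \<in> {..<n} \<rightarrow> F" and phi: "\<And>k. k < n \<Longrightarrow> \<phi> k \<in> loc_forms R M E p"
    and coord: "\<And>j k. j < n \<Longrightarrow> k < n \<Longrightarrow> \<phi> k (b j) = (if j = k then rfrac \<one> \<one> else rfrac \<zero> \<one>)"
    using loc_coordinates[OF free] by blast
  have "\<forall>j\<in>{..<n}. \<exists>x t. x \<in> N \<and> t \<in> S \<and> b j = frac x t"
    using b F unfolding loc_sub_def frac_def by blast
  then obtain x t where xt: "\<And>j. j < n \<Longrightarrow> x j \<in> N \<and> t j \<in> S \<and> b j = frac (x j) (t j)"
    by (metis lessThan_iff)
  have "\<exists>e s. k < n \<longrightarrow> e \<in> E \<and> s \<in> S \<and> \<phi> k = loc_form e s" for k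
    using loc_formsE[OF phi] by metis
  then obtain e s where es: "\<And>k. k < n \<Longrightarrow> e k \<in> E \<and> s k \<in> S \<and> \<phi> k = loc_form (e k) (s k)"
    by metis
  have val: "rfrac (e k (x j)) (s k \<otimes> t j) = (if j = k then rfrac \<one> \<one> else rfrac \<zero> \<one>)"
    if j: "j < n" and k: "k < n" for j k
  proof -
    have "x j \<in> carrier M" using xt[OF j] N by blast
    then show ?thesis
      using coord[OF j k] loc_form_frac[of "e k" "s k" "x j" "t j"] es[OF k] xt[OF j] by metis
  qed
  have xc: "x j \<in> carrier M" if "j < n" for j using xt[OF that] N by blast
  have ec: "e k (x j) \<in> carrier R" if "k < n" "j < n" for k j using es that xc by auto
  have st: "s k \<otimes> t j \<in> S" if "k < n" "j < n" for k j using es xt that by (intro S_mult) auto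
  have diag: "e k (x k) \<notin> p" if k: "k < n" for k
  proof
    assume ep: "e k (x k) \<in> p"
    have "rfrac (e k (x k)) (s k \<otimes> t k) = rfrac \<one> \<one>" using val[OF k k] by simp
    then obtain w where w: "w \<in> S" "(w \<otimes> \<one>) \<otimes> e k (x k) = (w \<otimes> (s k \<otimes> t k)) \<otimes> \<one>"
      using rfrac_eq_iff[OF ec[OF k k] R.one_closed st[OF k k] S_one] by blast
    have "(w \<otimes> \<one>) \<otimes> e k (x k) \<in> p" using ep w(1) by (intro P.I_l_closed) auto
    moreover have "(w \<otimes> (s k \<otimes> t k)) \<otimes> \<one> \<in> S"
      using S_mult[OF S_mult[OF w(1) st[OF k k]] S_one] .
    ultimately show False unfolding w(2) by blast
  qed
  have off: "e k (x j) \<in> p" if j: "j < n" and k: "k < n" and "j \<noteq> k" for j k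
  proof (rule ccontr)
    assume ep: "e k (x j) \<notin> p"
    have "rfrac (e k (x j)) (s k \<otimes> t j) = rfrac \<zero> \<one>" using val[OF j k] that(3) by simp
    then obtain w where w: "w \<in> S" "(w \<otimes> \<one>) \<otimes> e k (x j) = (w \<otimes> (s k \<otimes> t j)) \<otimes> \<zero>"
      using rfrac_eq_iff[OF ec[OF k j] R.zero_closed st[OF k j] S_one] by blast
    have "(w \<otimes> (s k \<otimes> t j)) \<otimes> \<zero> \<in> p" using w(1) st[OF k j] by simp
    moreover have "(w \<otimes> \<one>) \<otimes> e k (x j) \<in> S"
      using S_mult[OF S_mult[OF w(1) S_one], of "e k (x j)"] ep ec[OF k j] by blast
    ultimately show False unfolding w(2) by blast
  qed
  have "dual_at p {..<n} x e"
    unfolding dual_at_def using es xc diag off by simp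
  then have "indep_at p {..<n} x" unfolding indep_at_def by blast
  moreover have "x ` {..<n} \<subseteq> N" using xt by blast
  ultimately show ?thesis by (rule that)
qed

end

section \<open>From local summands to a global one\<close>

lemma (in form_space) free_summand_of_loc_summands:
  assumes noeth: "noetherian_ring R" and N: "submodule N R M" and fg: "fin_gen R (M\<lparr>carrier := N\<rparr>)"
    and loc: "\<forall>p \<in> j_spec R. \<exists>F n.
      free_E_summand (loc_ring R p) (loc_module R M p) (loc_forms R M E p) F n \<and>
      enat i + dim_in (j_spec R) p \<le> enat n \<and> F \<subseteq> loc_sub R M N p"
  shows "\<exists>F n. free_E_summand R M E F n \<and> i \<le> n \<and> F \<subseteq> N"
proof -
  have "\<exists>n b. indep_at p {..<n::nat} b \<and> b ` {..<n} \<subseteq> N \<and> enat i + dim_in (j_spec R) p \<le> enat n"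
    if p: "p \<in> j_spec R" for p
  proof -
    have "primeideal p R" using p by (simp add: j_spec_def)
    then interpret form_space_at_prime R M E p
      using form_space_axioms module_axioms
      by (simp add: form_space_at_prime_def module_at_prime_def)
    obtain F n where F: "free_E_summand (loc_ring R p) (loc_module R M p) (loc_forms R M E p) F n"
      "enat i + dim_in (j_spec R) p \<le> enat n" "F \<subseteq> loc_sub R M N p"
      using loc p by blast
    obtain x where "indep_at p {..<n} x" "x ` {..<n} \<subseteq> N"
      by (rule indep_at_of_loc_summand[OF F(1,3) submoduleE(1)[OF N]])
    then show ?thesis using F(2) by blast
  qed
  then obtain F where "free_E_summand R M E F i" "F \<subseteq> N"
    using free_summand_of_local_rank[OF noeth N fg] by blast
  then show ?thesis by blast
qed

theorem theorem4p8:
  fixes R :: "('a,'r) ring_scheme" and M :: "('a,'m) module"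
    and N :: "'m set" and E :: "('m \<Rightarrow> 'a) set" and i :: nat
  assumes "cring R" and "noetherian_ring R"
    and "module R M" and "fin_gen R M"
    and "submodule N R M" and "fin_gen R (M\<lparr>carrier := N\<rparr>)"
    and "hom_submodule R M E"
    and "0 < i"
    and "\<forall>p \<in> j_spec R. \<exists>F n.
           free_E_summand (loc_ring R p) (loc_module R M p) (loc_forms R M E p) F n \<and>
           enat i + dim_in (j_spec R) p \<le> enat n"
  shows "(\<exists>F n. free_E_summand R M E F n \<and> i \<le> n) \<and>
         ((\<forall>p \<in> j_spec R. \<exists>F n.
             free_E_summand (loc_ring R p) (loc_module R M p) (loc_forms R M E p) F n \<and>
             enat i + dim_in (j_spec R) p \<le> enat n \<and> F \<subseteq> loc_sub R M N p)
          \<longrightarrow> (\<exists>F n. free_E_summand R M E F n \<and> i \<le> n \<and> F \<subseteq> N))"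
proof -
  interpret form_space R M E
    using assms(3,7) by (simp add: form_space_def form_space_axioms_def)
  \<comment> \<open>The first assertion is the case where N is all of M: the inclusion in
    \<open>loc_sub\<close> then holds automatically, as \<open>F\<close> is a submodule of the
    localised module.\<close>
  have sub: "F \<subseteq> loc_sub R M (carrier M) p"
    if p: "p \<in> j_spec R"
      and F: "free_E_summand (loc_ring R p) (loc_module R M p) (loc_forms R M E p) F n" for p F n
  proof -
    have "primeideal p R" using p by (simp add: j_spec_def)
    then interpret module_at_prime R M p
      using assms(3) by (simp add: module_at_prime_def)
    have "submodule F (loc_ring R p) (loc_module R M p)"
      using F unfolding free_E_summand_def by (rule conjunct1)
    then have "F \<subseteq> carrier (loc_module R M p)"
      using subgroup.subset[OF submodule.axioms(1)] by fastforce
    then show ?thesis unfolding loc_sub_def carrier_loc_module frac_def .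
  qed
  have "\<forall>p \<in> j_spec R. \<exists>F n.
      free_E_summand (loc_ring R p) (loc_module R M p) (loc_forms R M E p) F n \<and>
      enat i + dim_in (j_spec R) p \<le> enat n \<and> F \<subseteq> loc_sub R M (carrier M) p"
  proof
    fix p assume p: "p \<in> j_spec R"
    obtain F n where F: "free_E_summand (loc_ring R p) (loc_module R M p) (loc_forms R M E p) F n"
      "enat i + dim_in (j_spec R) p \<le> enat n"
      using bspec[OF assms(9) p] by (elim exE conjE)
    then show "\<exists>F n. free_E_summand (loc_ring R p) (loc_module R M p) (loc_forms R M E p) F n \<and>
        enat i + dim_in (j_spec R) p \<le> enat n \<and> F \<subseteq> loc_sub R M (carrier M) p"
      using sub[OF p F(1)] by (intro exI conjI)
  qed
  moreover have "fin_gen R (M\<lparr>carrier := carrier M\<rparr>)" using assms(4) by simp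
  ultimately have "\<exists>F n. free_E_summand R M E F n \<and> i \<le> n \<and> F \<subseteq> carrier M"
    by (intro free_summand_of_loc_summands[OF assms(2) carrier_is_submodule])
  then have "\<exists>F n. free_E_summand R M E F n \<and> i \<le> n" by (elim exE conjE) (intro exI conjI)
  then show ?thesis
    by (intro conjI impI free_summand_of_loc_summands[OF assms(2,5,6)])
qed

end
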